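(* Let $G$ be a locally compact topological group with left Haar measure $\mu$ and right Haar measure $\widetilde\mu$, let $S\subseteq G$ be a Borel semi-group, and let $(\mu_p)_{p\in\mathbb N}$ be a sequence of measures on $G$ such that $\mu\gg\mu_1\gg\mu_2\gg\cdots$. Assume that for every $x,y\in S$ and for every $p\in\mathbb{N}$ $$\frac{d\mu_p}{d\mu}(xy)\le\frac{d\mu_p}{d\mu}(x)\,\frac{d\mu_p}{d\mu}(y).$$ Then, for all $p\ge q$ and every choice of $f\in L_2(S,\mu_q)$ and $g\in L_2(S,\mu_p)$, $$\|f*g\|_p\le\Big(\int_S\frac{d\mu_p}{d\mu_q}\,d\mu\Big)^{1/2}\|f\|_q\|g\|_p\quad\text{and}\quad \|g*f\|_p\le\Big(\int_S\frac{d\mu_p}{d\mu_q}\,d\widetilde\mu\Big)^{1/2}\|f\|_q\|g\|_p.$$ In particular, if there exists a non negative integer $d$ such that $$\int_S\frac{d\mu_p}{d\mu_q}\,d\mu<\infty\quad\text{and}\quad\int_S\frac{d\mu_p}{d\mu_q}\,d\widetilde\mu<\infty$$ for all positive integers $p,q$ such that $p>q+d$, then $\bigcup_p L_2(S,\mu_p)$ is a strong convolution algebra, with $A_{p,q}^2=\max\left(\int_S\frac{d\mu_p}{d\mu_q}d\mu,\ \int_S\frac{d\mu_p}{d\mu_q}d\widetilde\mu\right)$.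
   Context: $\|\cdot\|_p$ denotes the norm of $L_2(S,\mu_p)$. The right Haar measure is normalized by $\widetilde\mu(E)=\mu(E^{-1})$. The convolution of two measurable functions $f,g$ with respect to $S$ is $$(f*g)(x)=\int_{S\cap xS^{-1}}f(y)g(y^{-1}x)\,d\mu(y)$$ for any $x\in S$ such that the integral converges. Strong convolution algebra: $\bigcup_{p\in\mathbb N}L_2(S,\mu_p)$ is called a strong convolution algebra if there exists a non negative integer $d$ such that for every $p>q+d$ there exists a positive constant $A_{p,q}$ such that for every $f\in L_2(S,\mu_q)$ and $g\in L_2(S,\mu_p)$, $\|f*g\|_p\le A_{p,q}\|f\|_q\|g\|_p$ and $\|g*f\|_p\le A_{p,q}\|f\|_q\|g\|_p$. *)

theory Defs
  imports "HOL-Analysis.Analysis"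
begin

text \<open>
  The group is written additively, since the library's class of (not necessarily commutative)
  topological groups is \<^class>\<open>topological_group_add\<close>: the product \<open>x y\<close> is \<open>x + y\<close>,
  \<open>y\<inverse> x\<close> is \<open>- y + x\<close>, and \<open>x y\<inverse>\<close> is \<open>x - y\<close>. No commutativity is assumed.
\<close>

subsection \<open>Haar measures\<close>

definition radon_measure :: "'a::topological_space measure \<Rightarrow> bool" where
  "radon_measure \<mu> \<longleftrightarrow>
     sets \<mu> = sets borel \<and>
     (\<forall>K. compact K \<and> K \<in> sets borel \<longrightarrow> emeasure \<mu> K < \<infinity>) \<and>
     (\<forall>E\<in>sets borel. emeasure \<mu> E = (INF U\<in>{U. open U \<and> E \<subseteq> U}. emeasure \<mu> U)) \<and>
     (\<forall>U. open U \<longrightarrow>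
        emeasure \<mu> U = (SUP K\<in>{K. compact K \<and> K \<in> sets borel \<and> K \<subseteq> U}. emeasure \<mu> K))"

definition left_haar_measure :: "'a::topological_group_add measure \<Rightarrow> bool" where
  "left_haar_measure \<mu> \<longleftrightarrow>
     radon_measure \<mu> \<and> emeasure \<mu> UNIV \<noteq> 0 \<and>
     (\<forall>x. \<forall>E\<in>sets borel. emeasure \<mu> ((\<lambda>y. x + y) ` E) = emeasure \<mu> E)"

text \<open>The right Haar measure normalized by \<open>E \<mapsto> \<mu> (E\<inverse>)\<close>.\<close>

definition right_haar_of :: "'a::topological_group_add measure \<Rightarrow> 'a measure" where
  "right_haar_of \<mu> = distr \<mu> borel (\<lambda>x. - x)"

definition borel_semigroup :: "'a::topological_group_add set \<Rightarrow> bool" where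
  "borel_semigroup S \<longleftrightarrow> S \<in> sets borel \<and> (\<forall>x\<in>S. \<forall>y\<in>S. x + y \<in> S)"

subsection \<open>Radon--Nikodym derivatives\<close>

text \<open>
  \<open>w\<close> is a version of \<open>dN/dM\<close>; this is the property by which \<^const>\<open>RN_deriv\<close> selects its value.
  Pointwise inequalities between derivatives and integrals of \<open>dN/dM\<close> against measures other than
  \<open>M\<close> depend on the version, so a version is kept as an explicit function.
\<close>

definition is_RN_deriv :: "'a measure \<Rightarrow> 'a measure \<Rightarrow> ('a \<Rightarrow> ennreal) \<Rightarrow> bool" where
  "is_RN_deriv M N w \<longleftrightarrow> w \<in> borel_measurable M \<and> density M w = N"

subsection \<open>The spaces of square-integrable functions\<close>

text \<open>The square root on \<open>[0, \<infinity>]\<close>.\<close>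

definition ennsqrt :: "ennreal \<Rightarrow> ennreal" where
  "ennsqrt c = (if c = \<infinity> then \<infinity> else ennreal (sqrt (enn2real c)))"

definition L2_norm :: "'a set \<Rightarrow> 'a measure \<Rightarrow> ('a \<Rightarrow> complex) \<Rightarrow> ennreal" where
  "L2_norm S \<nu> f = ennsqrt (\<integral>\<^sup>+x\<in>S. ennreal ((cmod (f x))\<^sup>2) \<partial>\<nu>)"

text \<open>Elements are representatives; their values outside \<open>S\<close> are irrelevant.\<close>

definition L2 :: "'a set \<Rightarrow> 'a measure \<Rightarrow> ('a \<Rightarrow> complex) set" where
  "L2 S \<nu> = {f. f \<in> borel_measurable (restrict_space \<nu> S) \<and> L2_norm S \<nu> f < \<infinity>}"

subsection \<open>Convolution with respect to a semigroup\<close>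

text \<open>The domain of integration \<open>S \<inter> x S\<inverse>\<close>.\<close>

definition conv_domain :: "'a::group_add set \<Rightarrow> 'a \<Rightarrow> 'a set" where
  "conv_domain S x = S \<inter> (\<lambda>s. x - s) ` S"

definition convolution_exists ::
    "'a::group_add set \<Rightarrow> 'a measure \<Rightarrow> ('a \<Rightarrow> complex) \<Rightarrow> ('a \<Rightarrow> complex) \<Rightarrow> 'a \<Rightarrow> bool" where
  "convolution_exists S \<mu> f g x \<longleftrightarrow>
     set_integrable \<mu> (conv_domain S x) (\<lambda>y. f y * g (- y + x))"

definition convolution ::
    "'a::group_add set \<Rightarrow> 'a measure \<Rightarrow> ('a \<Rightarrow> complex) \<Rightarrow> ('a \<Rightarrow> complex) \<Rightarrow> 'a \<Rightarrow> complex" where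
  "convolution S \<mu> f g x = (LINT y:conv_domain S x|\<mu>. f y * g (- y + x))"

text \<open>
  The integral \<^const>\<open>convolution\<close> has the default value 0 where it does not converge. The next
  predicate says that \<open>f * g\<close> really is an element of \<open>L\<^sub>2(S, \<nu>)\<close>: the integral converges at
  \<open>\<nu>\<close>-almost every point of \<open>S\<close>, and the resulting function has a representative in the space.
\<close>

definition convolution_in_L2 ::
    "'a::group_add set \<Rightarrow> 'a measure \<Rightarrow> 'a measure \<Rightarrow> ('a \<Rightarrow> complex) \<Rightarrow> ('a \<Rightarrow> complex) \<Rightarrow> bool" where
  "convolution_in_L2 S \<mu> \<nu> f g \<longleftrightarrow>
     (AE x in \<nu>. x \<in> S \<longrightarrow> convolution_exists S \<mu> f g x) \<and>
     (\<exists>h\<in>L2 S \<nu>. AE x in \<nu>. x \<in> S \<longrightarrow> convolution S \<mu> f g x = h x)"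

subsection \<open>Strong convolution algebras\<close>

definition convolution_bound ::
    "'a::group_add set \<Rightarrow> 'a measure \<Rightarrow> (nat \<Rightarrow> 'a measure) \<Rightarrow> nat \<Rightarrow> nat \<Rightarrow> real \<Rightarrow> bool" where
  "convolution_bound S \<mu> M p q A \<longleftrightarrow>
     (\<forall>f\<in>L2 S (M q). \<forall>g\<in>L2 S (M p).
        convolution_in_L2 S \<mu> (M p) f g \<and>
        L2_norm S (M p) (convolution S \<mu> f g) \<le> ennreal A * L2_norm S (M q) f * L2_norm S (M p) g \<and>
        convolution_in_L2 S \<mu> (M p) g f \<and>
        L2_norm S (M p) (convolution S \<mu> g f) \<le> ennreal A * L2_norm S (M q) f * L2_norm S (M p) g)"

text \<open>The sequence \<open>M\<close> is indexed by the positive integers; \<open>M 0\<close> is not used.\<close>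

definition strong_convolution_algebra ::
    "'a::group_add set \<Rightarrow> 'a measure \<Rightarrow> (nat \<Rightarrow> 'a measure) \<Rightarrow> bool" where
  "strong_convolution_algebra S \<mu> M \<longleftrightarrow>
     (\<exists>d::nat. \<forall>p q. 1 \<le> q \<and> p > q + d \<longrightarrow> (\<exists>A>0. convolution_bound S \<mu> M p q A))"

end

theory Submission
  imports Defs
begin

text \<open>
  Put \<open>w\<^sub>p = d\<mu>\<^sub>p/d\<mu>\<close>, so that \<open>w\<^sub>p = w\<^sub>q d\<mu>\<^sub>p/d\<mu>\<^sub>q\<close> almost everywhere on the relevant supports. By
  submultiplicativity \<open>w\<^sub>p(z) \<le> w\<^sub>p(y) w\<^sub>p(y\<inverse> z)\<close>, and the Cauchy--Schwarz inequality gives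
  \<open>w\<^sub>p(z) (|f| * |g|)(z)\<^sup>2 \<le> (\<integral>\<^sub>S d\<mu>\<^sub>p/d\<mu>\<^sub>q d\<mu>) (|f|\<^sup>2 w\<^sub>q * |g|\<^sup>2 w\<^sub>p)(z)\<close>; integrating over \<open>z\<close> with Tonelli's
  theorem and left invariance gives the bound. For \<open>g * f\<close> the factor \<open>d\<mu>\<^sub>p/d\<mu>\<^sub>q\<close> is evaluated at
  \<open>y\<inverse> z\<close>, and translating \<open>y\<close> turns its integral into one against the right Haar measure.

  The group need not be \<open>\<sigma>\<close>-compact or second countable. Tonelli's inequality for the convolution is
  therefore proved directly: for open sets by \<open>\<tau>\<close>-additivity of Radon measures, for Borel sets of
  finite measure by outer regularity, and for functions with \<open>\<sigma>\<close>-finite support by monotone limits.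
\<close>

subsection \<open>Radon measures and directed families of lower semicontinuous functions\<close>

text \<open>One observation repairs all three. A finite norm of f makes |f|^2 w_q integrable, so f
  has \<sigma>-finite support inside {w_q > 0}. On {w_q = 0} the function w_p vanishes almost
  everywhere. Where w_p vanishes at y or at y^-1 z, submultiplicativity makes it vanish at z as
  well, so such points do not influence the convolution at any z that \<open>\<mu>\<^sub>p\<close>
  sees. Hence f and g may be replaced by functions with \<sigma>-finite support, and on such
  supports the densities are unique and Tonelli's inequality can be proved. The asymmetry between
  the two bounds comes from the place of the derivative: for g * f the identity is needed at y^-1 z,
  and its exceptional null set has to be moved there, which is possible only for almost every
  z.\<close>

lemma radon_measure_sets: "radon_measure \<nu> \<Longrightarrow> sets \<nu> = sets borel"
  by (simp add: radon_measure_def)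

lemma radon_measure_space: "radon_measure \<nu> \<Longrightarrow> space \<nu> = UNIV"
  using sets_eq_imp_space_eq[of \<nu> borel] by (simp add: radon_measure_def)

lemma radon_measure_compact_finite:
  fixes \<nu> :: "'a::t2_space measure"
  shows "radon_measure \<nu> \<Longrightarrow> compact K \<Longrightarrow> emeasure \<nu> K < \<infinity>"
  by (auto simp: radon_measure_def borel_closed compact_imp_closed)

lemma radon_measure_open_SUP:
  fixes \<nu> :: "'a::t2_space measure"
  assumes "radon_measure \<nu>" "open U"
  shows "emeasure \<nu> U = (SUP K\<in>{K. compact K \<and> K \<subseteq> U}. emeasure \<nu> K)"
proof -
  have "{K. compact K \<and> K \<in> sets borel \<and> K \<subseteq> U} = {K. compact K \<and> K \<subseteq> U}"
    by (auto simp: borel_closed compact_imp_closed)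
  then show ?thesis
    using assms unfolding radon_measure_def by metis
qed

text \<open>A lower Riemann sum, with step 1/n, for the layer-cake integral of r. Taking
  \<open>n*n\<close> levels lets the heights reach n, so that r = \<infinity> is covered. The strict
  inequality \<open>k / n < r\<close> matches the open superlevel sets of lower semicontinuous
  functions.\<close>

lemma layer_sum_liminf:
  fixes r :: ennreal
  shows "r \<le> liminf (\<lambda>n. \<Sum>k=1..n*n. if ennreal (real k / real n) < r then ennreal (1 / real n) else 0)"
  unfolding le_Liminf_iff
proof (intro allI impI)
  fix y assume "y < r"
  then obtain z where z: "y < z" "z < r"
    using dense by blast
  obtain y' where y': "y = ennreal y'" "0 \<le> y'"
    using z by (cases y) auto
  obtain t where t: "z = ennreal t" "0 \<le> t"
    using z by (cases z) auto
  have yt: "y' < t"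
    using z y' t by (simp add: ennreal_less_iff)
  \<comment> \<open>\<open>N > t\<close> will keep \<open>m\<close> within the \<open>n*n\<close>
    levels; \<open>N > 1 / (t - y')\<close> makes the step smaller than the gap, so that rounding
    \<open>t\<close> down to a multiple of 1/n still stays above \<open>y'\<close>.\<close>
  obtain N :: nat where N: "N > max t (1 / (t - y'))" "N > 0"
    by (meson less_trans reals_Archimedean2 gr0I max_less_iff_conj of_nat_less_0_iff
        less_le_trans not_less0 gt_ex of_nat_less_iff)
  show "\<forall>\<^sub>F n in sequentially.
      y < (\<Sum>k=1..n*n. if ennreal (real k / real n) < r then ennreal (1 / real n) else 0)"
    using eventually_ge_at_top[of N]
  proof eventually_elim
    case (elim n)
    then have n: "real n > t" "real n > 1 / (t - y')" "n > 0"
      using N by (auto intro: less_le_trans)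
    define m where "m = nat \<lfloor>real n * t\<rfloor>"
    have m: "real m \<le> real n * t" "real n * t < real m + 1"
      using t(2) by (auto simp: m_def)
    have "real m \<le> real n * real n"
      using m(1) n t(2) by (meson less_imp_le mult_left_mono of_nat_0_le_iff order_trans)
    then have mn: "m \<le> n * n"
      by (metis of_nat_le_iff of_nat_mult)
    have "1 < real n * (t - y')"
      using n(2) yt by (simp add: field_simps)
    then have "real n * y' < real m"
      using m(2) by (simp add: algebra_simps)
    then have "y' < real m / real n"
      using n(3) by (simp add: field_simps)
    then have "y < ennreal (real m / real n)"
      using y' by (simp add: ennreal_less_iff)
    also have "\<dots> = (\<Sum>k=1..m. ennreal (1 / real n))"
      by (simp add: ennreal_of_nat_eq_real_of_nat flip: ennreal_mult)
    also have "\<dots> = (\<Sum>k=1..m. if ennreal (real k / real n) < r then ennreal (1 / real n) else 0)"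
    proof (intro sum.cong refl)
      fix k assume "k \<in> {1..m}"
      then have "real k \<le> real n * t"
        using m(1) by auto
      then have "real k / real n \<le> t"
        using n(3) by (simp add: field_simps)
      then have "ennreal (real k / real n) < r"
        using z t by (metis ennreal_leI le_less_trans)
      then show "ennreal (1 / real n) =
          (if ennreal (real k / real n) < r then ennreal (1 / real n) else 0)"
        by simp
    qed
    also have "\<dots> \<le> (\<Sum>k=1..n*n. if ennreal (real k / real n) < r then ennreal (1 / real n) else 0)"
      using mn by (intro sum_mono2) auto
    finally show ?case .
  qed
qed

lemma directed_finite_upper_bound:
  fixes \<Phi> :: "('a \<Rightarrow> ennreal) set"
  assumes "\<Phi> \<noteq> {}"
    and dir: "\<And>f g. f \<in> \<Phi> \<Longrightarrow> g \<in> \<Phi> \<Longrightarrow> \<exists>h\<in>\<Phi>. f \<le> h \<and> g \<le> h"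
    and "finite F" "F \<subseteq> \<Phi>"
  shows "\<exists>h\<in>\<Phi>. \<forall>f\<in>F. f \<le> h"
  using assms(3,4)
proof (induction F rule: finite_induct)
  case empty
  then show ?case using assms(1) by auto
next
  case (insert f F)
  then obtain h where "h \<in> \<Phi>" "\<forall>f\<in>F. f \<le> h"
    by auto
  moreover obtain h' where "h' \<in> \<Phi>" "f \<le> h'" "h \<le> h'"
    using dir[of f h] insert calculation by auto
  ultimately show ?case
    by (metis insert_iff order_trans)
qed

text \<open>The compactness argument of Dini's theorem: the open sets {c < f} cover K, and an upper
  bound of a finite subcover lies in the directed family.\<close>

lemma directed_lsc_on_compact:
  fixes \<Phi> :: "('a::topological_space \<Rightarrow> ennreal) set"
  assumes ne: "\<Phi> \<noteq> {}"
    and dir: "\<And>f g. f \<in> \<Phi> \<Longrightarrow> g \<in> \<Phi> \<Longrightarrow> \<exists>h\<in>\<Phi>. f \<le> h \<and> g \<le> h"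
    and lsc: "\<And>f c. f \<in> \<Phi> \<Longrightarrow> open {x. c < f x}"
    and K: "compact K" "\<And>x. x \<in> K \<Longrightarrow> c < (SUP f\<in>\<Phi>. f x)"
  shows "\<exists>f\<in>\<Phi>. \<forall>x\<in>K. c < f x"
proof -
  have cov: "K \<subseteq> (\<Union>f\<in>\<Phi>. {x. c < f x})"
    using K(2) by (auto simp: less_SUP_iff)
  obtain F where F: "F \<subseteq> \<Phi>" "finite F" "K \<subseteq> (\<Union>f\<in>F. {x. c < f x})"
    using compactE_image[OF K(1) _ cov] lsc by metis
  obtain h where h: "h \<in> \<Phi>" "\<forall>f\<in>F. f \<le> h"
    using directed_finite_upper_bound[OF ne dir F(2,1)] by blast
  have "\<forall>x\<in>K. c < h x"
  proof
    fix x assume "x \<in> K"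
    then obtain f where "f \<in> F" "c < f x"
      using F(3) by auto
    then show "c < h x"
      using h(2) by (meson le_funD less_le_trans)
  qed
  then show ?thesis
    using h(1) by blast
qed

text \<open>One member \<open>h\<close> of the family beats all finitely many levels at once. At a
  point x only the largest level m with x in \<open>K m\<close> matters: the levels start at 1, so
  at most m of the sets contain x, and m/n < h x. The compact sets of different levels can therefore
  be chosen independently, without nesting.\<close>

lemma directed_lsc_layer_bound:
  fixes \<nu> :: "'a::t2_space measure" and \<Phi> :: "('a \<Rightarrow> ennreal) set"
  assumes \<nu>: "radon_measure \<nu>" and ne: "\<Phi> \<noteq> {}"
    and dir: "\<And>f g. f \<in> \<Phi> \<Longrightarrow> g \<in> \<Phi> \<Longrightarrow> \<exists>h\<in>\<Phi>. f \<le> h \<and> g \<le> h"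
    and lsc: "\<And>f c. f \<in> \<Phi> \<Longrightarrow> open {x. c < f x}"
    and n: "n > 0"
    and K: "\<And>k. compact (K k)" "\<And>k x. x \<in> K k \<Longrightarrow> ennreal (real k / real n) < (SUP f\<in>\<Phi>. f x)"
  shows "(\<Sum>k=1..n*n. ennreal (1 / real n) * emeasure \<nu> (K k)) \<le> (SUP f\<in>\<Phi>. \<integral>\<^sup>+x. f x \<partial>\<nu>)"
proof -
  have "\<exists>f\<in>\<Phi>. \<forall>x\<in>K k. ennreal (real k / real n) < f x" for k
    using directed_lsc_on_compact[OF ne dir lsc K(1)] K(2) by blast
  then obtain f where f: "\<And>k. f k \<in> \<Phi>" "\<And>k x. x \<in> K k \<Longrightarrow> ennreal (real k / real n) < f k x"
    by metis
  obtain h where h: "h \<in> \<Phi>" "\<forall>g\<in>f ` {1..n*n}. g \<le> h"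
    using directed_finite_upper_bound[OF ne dir, of "f ` {1..n*n}"] f(1) by auto
  have Kb: "K k \<in> sets \<nu>" for k
    using K(1) \<nu> by (simp add: radon_measure_sets borel_closed compact_imp_closed)
  have "(\<Sum>k=1..n*n. ennreal (1 / real n) * emeasure \<nu> (K k))
      = (\<integral>\<^sup>+x. (\<Sum>k=1..n*n. ennreal (1 / real n) * indicator (K k) x) \<partial>\<nu>)"
    using Kb by (subst nn_integral_sum) (auto simp: nn_integral_cmult_indicator)
  also have "\<dots> \<le> (\<integral>\<^sup>+x. h x \<partial>\<nu>)"
  proof (rule nn_integral_mono)
    fix x
    define I where "I = {k\<in>{1..n*n}. x \<in> K k}"
    have "(\<Sum>k=1..n*n. ennreal (1 / real n) * indicator (K k) x) = (\<Sum>k\<in>I. ennreal (1 / real n))"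
      unfolding I_def by (intro sum.mono_neutral_cong_right) (auto simp: indicator_def)
    also have "\<dots> = ennreal (real (card I) / real n)"
      by (simp add: ennreal_of_nat_eq_real_of_nat flip: ennreal_mult)
    also have "\<dots> \<le> h x"
    proof (cases "I = {}")
      case False
      have "finite I" by (simp add: I_def)
      define m where "m = Max I"
      have "m \<in> I"
        unfolding m_def by (rule Max_in) (use False \<open>finite I\<close> in auto)
      moreover have "k \<le> m" if "k \<in> I" for k
        unfolding m_def using that \<open>finite I\<close> by (rule Max_ge[rotated])
      ultimately have m: "m \<in> I" "I \<subseteq> {1..m}"
        by (auto simp: I_def)
      then have "card I \<le> m"
        using card_mono[of "{1..m}" I] by simp
      then have "ennreal (real (card I) / real n) \<le> ennreal (real m / real n)"
        by (intro ennreal_leI divide_right_mono) auto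
      also have "\<dots> \<le> f m x"
        using f(2)[of x m] m by (simp add: I_def less_imp_le)
      also have "\<dots> \<le> h x"
        using h(2) m by (auto simp: I_def le_fun_def)
      finally show ?thesis .
    qed auto
    finally show "(\<Sum>k=1..n*n. ennreal (1 / real n) * indicator (K k) x) \<le> h x" .
  qed
  also have "\<dots> \<le> (SUP f\<in>\<Phi>. \<integral>\<^sup>+x. f x \<partial>\<nu>)"
    by (rule SUP_upper) fact
  finally show ?thesis .
qed

text \<open>
  A Radon measure need not be \<open>\<sigma>\<close>-finite, so the directed family is not reduced to a sequence:
  the superlevel sets of the supremum are open, and on compact subsets of finitely many of them
  a single member of the family already exceeds the levels.
\<close>

lemma nn_integral_directed_lsc_le:
  fixes \<nu> :: "'a::t2_space measure" and \<Phi> :: "('a \<Rightarrow> ennreal) set"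
  assumes \<nu>: "radon_measure \<nu>" and ne: "\<Phi> \<noteq> {}"
    and dir: "\<And>f g. f \<in> \<Phi> \<Longrightarrow> g \<in> \<Phi> \<Longrightarrow> \<exists>h\<in>\<Phi>. f \<le> h \<and> g \<le> h"
    and lsc: "\<And>f c. f \<in> \<Phi> \<Longrightarrow> open {x. c < f x}"
  shows "(\<integral>\<^sup>+x. (SUP f\<in>\<Phi>. f x) \<partial>\<nu>) \<le> (SUP f\<in>\<Phi>. \<integral>\<^sup>+x. f x \<partial>\<nu>)"
proof -
  let ?S = "SUP f\<in>\<Phi>. \<integral>\<^sup>+x. f x \<partial>\<nu>"
  define s where "s x = (SUP f\<in>\<Phi>. f x)" for x
  define U where "U n k = {x. ennreal (real k / real n) < s x}" for n k :: nat
  have "U n k = (\<Union>f\<in>\<Phi>. {x. ennreal (real k / real n) < f x})" for n k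
    by (auto simp: U_def s_def less_SUP_iff)
  then have U: "open (U n k)" for n k
    using lsc by auto
  then have Ub: "U n k \<in> sets \<nu>" for n k
    using \<nu> by (simp add: radon_measure_sets)
  define \<phi> where "\<phi> n x = (\<Sum>k=1..n*n. ennreal (1 / real n) * indicator (U n k) x)" for n x
  have \<phi>[measurable]: "\<phi> n \<in> borel_measurable \<nu>" for n
    unfolding \<phi>_def using Ub by measurable
  have bound: "(\<integral>\<^sup>+x. \<phi> n x \<partial>\<nu>) \<le> ?S" if n: "n > 0" for n
  proof -
    \<comment> \<open>The measure of \<open>U n k\<close> may be infinite, so it is approached along
      a sequence of compact sets instead of up to an \<epsilon>.\<close>
    have "\<exists>a. incseq a \<and> range a \<subseteq> emeasure \<nu> ` {K. compact K \<and> K \<subseteq> U n k}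
        \<and> emeasure \<nu> (U n k) = (SUP i. a i)" for k
      unfolding radon_measure_open_SUP[OF \<nu> U]
      by (rule ennreal_Sup_countable_SUP) auto
    then obtain a where a: "\<And>k. incseq (a k)"
        "\<And>k. range (a k) \<subseteq> emeasure \<nu> ` {K. compact K \<and> K \<subseteq> U n k}"
        "\<And>k. emeasure \<nu> (U n k) = (SUP i. a k i)"
      by metis
    have "\<exists>K. compact K \<and> K \<subseteq> U n k \<and> a k i = emeasure \<nu> K" for k i
      using a(2)[of k] by blast
    then obtain K where K: "\<And>k i. compact (K k i)" "\<And>k i. K k i \<subseteq> U n k"
        "\<And>k i. a k i = emeasure \<nu> (K k i)"
      by metis
    have "(\<lambda>i. \<Sum>k=1..n*n. ennreal (1 / real n) * a k i)
        \<longlonglongrightarrow> (\<Sum>k=1..n*n. ennreal (1 / real n) * emeasure \<nu> (U n k))"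
    proof (intro tendsto_sum ennreal_tendsto_cmult)
      show "a k \<longlonglongrightarrow> emeasure \<nu> (U n k)" for k
        unfolding a(3) by (rule LIMSEQ_SUP[OF a(1)])
    qed auto
    moreover have "(\<Sum>k=1..n*n. ennreal (1 / real n) * a k i) \<le> ?S" for i
      unfolding K(3)
      by (rule directed_lsc_layer_bound[OF \<nu> ne dir lsc n K(1)])
         (use K(2) in \<open>auto simp: U_def s_def\<close>)
    ultimately have "(\<Sum>k=1..n*n. ennreal (1 / real n) * emeasure \<nu> (U n k)) \<le> ?S"
      by (intro LIMSEQ_le_const2[where X="\<lambda>i. \<Sum>k=1..n*n. ennreal (1 / real n) * a k i"]) auto
    then show ?thesis
      unfolding \<phi>_def using Ub
      by (subst nn_integral_sum) (auto simp: nn_integral_cmult_indicator)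
  qed
  \<comment> \<open>The sums \<open>\<phi> n\<close> are not monotone in n, so Fatou's lemma takes
    the place of monotone convergence.\<close>
  have "(\<integral>\<^sup>+x. s x \<partial>\<nu>) \<le> (\<integral>\<^sup>+x. liminf (\<lambda>n. \<phi> n x) \<partial>\<nu>)"
  proof (rule nn_integral_mono)
    fix x
    have "\<phi> n x = (\<Sum>k=1..n*n. if ennreal (real k / real n) < s x then ennreal (1 / real n) else 0)" for n
      unfolding \<phi>_def U_def by (intro sum.cong refl) (simp add: indicator_def)
    then show "s x \<le> liminf (\<lambda>n. \<phi> n x)"
      using layer_sum_liminf[of "s x"] by simp
  qed
  also have "\<dots> \<le> liminf (\<lambda>n. \<integral>\<^sup>+x. \<phi> n x \<partial>\<nu>)"
    by (intro nn_integral_liminf) measurable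
  also have "\<dots> \<le> limsup (\<lambda>n. \<integral>\<^sup>+x. \<phi> n x \<partial>\<nu>)"
    by (rule Liminf_le_Limsup) simp
  also have "\<dots> \<le> ?S"
    by (rule Limsup_bounded[OF eventually_mono[OF eventually_gt_at_top[of 0] bound]])
  finally show ?thesis
    by (simp add: s_def)
qed

subsection \<open>Open subsets of a product of locally compact spaces\<close>

text \<open>The compactness step of the tube lemma for K \<times> {z}. The family is arbitrary
  because it is needed once for all open rectangles inside an open set and once for those of finite
  measure.\<close>

lemma compact_finite_rectangles:
  assumes "compact K"
    and ex: "\<And>y. y \<in> K \<Longrightarrow> \<exists>(U, V)\<in>\<R>. open U \<and> y \<in> U \<and> z \<in> V"
  shows "\<exists>R. finite R \<and> R \<subseteq> \<R> \<and> (\<forall>(U, V)\<in>R. z \<in> V) \<and> K \<subseteq> (\<Union>(U, V)\<in>R. U)"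
proof -
  define \<R>' where "\<R>' = {(U, V) \<in> \<R>. open U \<and> z \<in> V}"
  have "K \<subseteq> (\<Union>p\<in>\<R>'. fst p)"
    using ex by (fastforce simp: \<R>'_def)
  moreover have "open (fst p)" if "p \<in> \<R>'" for p
    using that by (auto simp: \<R>'_def)
  ultimately obtain R where "R \<subseteq> \<R>'" "finite R" "K \<subseteq> (\<Union>p\<in>R. fst p)"
    using compactE_image[OF assms(1), of \<R>' fst] by metis
  then show ?thesis
    by (intro exI[of _ R]) (fastforce simp: \<R>'_def)
qed

lemma open_prod_rectangle:
  assumes "open W" "(y, z) \<in> W"
  shows "\<exists>A B. open A \<and> open B \<and> y \<in> A \<and> z \<in> B \<and> A \<times> B \<subseteq> W"
  using assms unfolding open_prod_def by fastforce

lemma open_section: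
  fixes W :: "('a::topological_space \<times> 'b::topological_space) set"
  assumes "open W"
  shows "open {y. (y, z) \<in> W}" "open {z. (y, z) \<in> W}"
  using open_vimage[OF assms, of "\<lambda>y. (y, z)"] open_vimage[OF assms, of "\<lambda>z. (y, z)"]
  by (simp_all add: vimage_def continuous_on_Pair)

text \<open>Lower semicontinuity of the section measure. Inner regularity gives a compact K in the
  section at z with measure above c; finitely many rectangles cover K \<times> {z}, and for every
  point of the intersection of their second sides K still lies in the section. This is also the
  source of measurability for open sets outside the product \<sigma>-algebra.\<close>

lemma open_emeasure_section_gt:
  fixes \<mu> :: "'a::t2_space measure" and W :: "('a \<times> 'b::topological_space) set"
  assumes \<mu>: "radon_measure \<mu>" and W: "open W"
  shows "open {z. c < emeasure \<mu> {y. (y, z) \<in> W}}"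
proof (subst open_subopen, intro ballI)
  fix z assume "z \<in> {z. c < emeasure \<mu> {y. (y, z) \<in> W}}"
  then obtain K where K: "compact K" "K \<subseteq> {y. (y, z) \<in> W}" "c < emeasure \<mu> K"
    using radon_measure_open_SUP[OF \<mu> open_section(1)[OF W], of z] by (auto simp: less_SUP_iff)
  have "\<exists>(U, V)\<in>{(U, V). open U \<and> open V \<and> U \<times> V \<subseteq> W}. open U \<and> y \<in> U \<and> z \<in> V"
    if "y \<in> K" for y
  proof -
    have "(y, z) \<in> W"
      using K(2) that by auto
    then show ?thesis
      using open_prod_rectangle[OF W] by fastforce
  qed
  from compact_finite_rectangles[OF K(1) this]
  obtain R where R: "finite R" "\<forall>(U, V)\<in>R. open V \<and> U \<times> V \<subseteq> W" "\<forall>(U, V)\<in>R. z \<in> V"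
      "K \<subseteq> (\<Union>(U, V)\<in>R. U)"
    by fastforce
  have "open (\<Inter>p\<in>R. snd p)"
    using R(1,2) by (intro open_INT) auto
  moreover have "z \<in> (\<Inter>p\<in>R. snd p)"
    using R(3) by auto
  moreover have "(\<Inter>p\<in>R. snd p) \<subseteq> {z. c < emeasure \<mu> {y. (y, z) \<in> W}}"
  proof
    fix z' assume z': "z' \<in> (\<Inter>p\<in>R. snd p)"
    have "K \<subseteq> {y. (y, z') \<in> W}"
      using R z' by fastforce
    then have "emeasure \<mu> K \<le> emeasure \<mu> {y. (y, z') \<in> W}"
      using \<mu> open_section(1)[OF W] by (intro emeasure_mono) (auto simp: radon_measure_sets)
    then show "z' \<in> {z. c < emeasure \<mu> {y. (y, z) \<in> W}}"
      using K(3) by auto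
  qed
  ultimately show "\<exists>T. open T \<and> z \<in> T \<and> T \<subseteq> {z. c < emeasure \<mu> {y. (y, z) \<in> W}}"
    by blast
qed

lemma borel_measurable_emeasure_section:
  fixes \<mu> :: "'a::t2_space measure" and W :: "('a \<times> 'b::topological_space) set"
  assumes "radon_measure \<mu>" "open W"
  shows "(\<lambda>z. emeasure \<mu> {y. (y, z) \<in> W}) \<in> borel_measurable borel"
  using open_emeasure_section_gt[OF assms] by (intro borel_measurableI_greater) auto

text \<open>A finite union of rectangles does lie in the product \<sigma>-algebra and lives on C
  \<times> C' with both sides of finite measure. Cutting the measures down to C and C' makes them
  finite, and the classical theorem applies.\<close>

lemma nn_integral_section_finite_rectangles:
  fixes \<mu> :: "'a::t2_space measure" and \<nu> :: "'b::t2_space measure"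
  assumes \<mu>: "radon_measure \<mu>" and \<nu>: "radon_measure \<nu>" and "finite R"
    and R: "\<And>U V. (U, V) \<in> R \<Longrightarrow>
      open U \<and> open V \<and> emeasure \<mu> U < \<infinity> \<and> emeasure \<nu> V < \<infinity>"
  defines "W \<equiv> \<Union>(U, V)\<in>R. U \<times> V"
  shows "(\<integral>\<^sup>+z. emeasure \<mu> {y. (y, z) \<in> W} \<partial>\<nu>) = (\<integral>\<^sup>+y. emeasure \<nu> {z. (y, z) \<in> W} \<partial>\<mu>)"
proof -
  note [simp] = radon_measure_sets[OF \<mu>] radon_measure_sets[OF \<nu>]
    radon_measure_space[OF \<mu>] radon_measure_space[OF \<nu>]
  have [measurable_cong]: "sets \<mu> = sets borel" "sets \<nu> = sets borel" by simp_all
  define C where "C = (\<Union>(U, V)\<in>R. U)"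
  define C' where "C' = (\<Union>(U, V)\<in>R. V)"
  have oC: "open C" "open C'"
    using R by (auto simp: C_def C'_def)
  then have [measurable]: "C \<in> sets borel" "C' \<in> sets borel"
    by auto
  have "emeasure \<mu> C \<le> (\<Sum>p\<in>R. emeasure \<mu> (fst p))"
    unfolding C_def case_prod_beta using R \<open>finite R\<close>
    by (intro emeasure_subadditive_finite) auto
  also have "\<dots> < \<infinity>"
    using R \<open>finite R\<close> by (auto simp: less_top)
  finally have fC: "emeasure \<mu> C < \<infinity>" .
  have "emeasure \<nu> C' \<le> (\<Sum>p\<in>R. emeasure \<nu> (snd p))"
    unfolding C'_def case_prod_beta using R \<open>finite R\<close>
    by (intro emeasure_subadditive_finite) auto
  also have "\<dots> < \<infinity>"
    using R \<open>finite R\<close> by (auto simp: less_top)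
  finally have fC': "emeasure \<nu> C' < \<infinity>" .
  define M1 where "M1 = density \<mu> (indicator C)"
  define M2 where "M2 = density \<nu> (indicator C')"
  have [measurable_cong]: "sets M1 = sets borel" "sets M2 = sets borel"
    by (simp_all add: M1_def M2_def)
  interpret M1: finite_measure M1
    by standard (use fC in \<open>simp add: M1_def emeasure_density\<close>)
  interpret M2: finite_measure M2
    by standard (use fC' in \<open>simp add: M2_def emeasure_density\<close>)
  interpret pair_sigma_finite M1 M2 ..
  have oW: "open W"
    using R unfolding W_def by (auto intro!: open_Times)
  have WM: "W \<in> sets (M1 \<Otimes>\<^sub>M M2)"
    unfolding W_def
  proof (rule sets.finite_UN[OF \<open>finite R\<close>], clarify)
    fix U V assume "(U, V) \<in> R"
    then show "U \<times> V \<in> sets (M1 \<Otimes>\<^sub>M M2)"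
      using R by (intro pair_measureI) (auto simp: M1_def M2_def)
  qed
  have s1: "emeasure M1 {y. (y, z) \<in> W} = emeasure \<mu> {y. (y, z) \<in> W}" for z
  proof -
    have "{y. (y, z) \<in> W} \<inter> C = {y. (y, z) \<in> W}"
      by (auto simp: W_def C_def)
    then show ?thesis
      using open_section(1)[OF oW, of z]
      by (simp add: M1_def emeasure_density Int_commute flip: indicator_inter_arith)
  qed
  have s2: "emeasure M2 {z. (y, z) \<in> W} = emeasure \<nu> {z. (y, z) \<in> W}" for y
  proof -
    have "{z. (y, z) \<in> W} \<inter> C' = {z. (y, z) \<in> W}"
      by (auto simp: W_def C'_def)
    then show ?thesis
      using open_section(2)[OF oW, of y]
      by (simp add: M2_def emeasure_density Int_commute flip: indicator_inter_arith)
  qed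
  have oW': "open {(z, y). (y, z) \<in> W}"
    using open_vimage[OF oW continuous_on_swap[of UNIV]] 
    by (simp add: vimage_def prod.swap_def case_prod_unfold)
  have m1: "(\<lambda>z. emeasure \<mu> {y. (y, z) \<in> W}) \<in> borel_measurable \<nu>"
    using borel_measurable_emeasure_section[OF \<mu> oW] by simp
  have m2: "(\<lambda>y. emeasure \<nu> {z. (y, z) \<in> W}) \<in> borel_measurable \<mu>"
    using borel_measurable_emeasure_section[OF \<nu> oW'] by simp
  \<comment> \<open>Sections over points outside C' are empty, so integrating against
    \<open>M2\<close> or against \<open>\<nu>\<close> is the same.\<close>
  have z1: "indicator C' z * emeasure \<mu> {y. (y, z) \<in> W} = emeasure \<mu> {y. (y, z) \<in> W}" for z
  proof (cases "z \<in> C'")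
    case False
    then have "{y. (y, z) \<in> W} = {}"
      by (auto simp: W_def C'_def)
    then show ?thesis by simp
  qed auto
  have z2: "indicator C y * emeasure \<nu> {z. (y, z) \<in> W} = emeasure \<nu> {z. (y, z) \<in> W}" for y
  proof (cases "y \<in> C")
    case False
    then have "{z. (y, z) \<in> W} = {}"
      by (auto simp: W_def C_def)
    then show ?thesis by simp
  qed auto
  have "(\<integral>\<^sup>+z. emeasure \<mu> {y. (y, z) \<in> W} \<partial>\<nu>) = (\<integral>\<^sup>+z. emeasure \<mu> {y. (y, z) \<in> W} \<partial>M2)"
    unfolding M2_def by (subst nn_integral_density) (use m1 in \<open>auto simp: z1\<close>)
  also have "\<dots> = emeasure (M1 \<Otimes>\<^sub>M M2) W"
    by (subst emeasure_pair_measure_alt2[OF WM]) (simp add: vimage_def s1)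
  also have "\<dots> = (\<integral>\<^sup>+y. emeasure \<nu> {z. (y, z) \<in> W} \<partial>M1)"
    by (subst M2.emeasure_pair_measure_alt[OF WM]) (simp add: vimage_def s2)
  also have "\<dots> = (\<integral>\<^sup>+y. emeasure \<nu> {z. (y, z) \<in> W} \<partial>\<mu>)"
    unfolding M1_def by (subst nn_integral_density) (use m2 in \<open>auto simp: z2\<close>)
  finally show ?thesis .
qed

lemma locally_compact_finite_nbhd:
  fixes \<mu> :: "'a::t2_space measure"
  assumes "locally_compact_space (euclidean :: 'a topology)" "radon_measure \<mu>" "open U" "x \<in> U"
  shows "\<exists>V. open V \<and> x \<in> V \<and> V \<subseteq> U \<and> emeasure \<mu> V < \<infinity>"
proof -
  obtain V K where V: "open V" "compact K" "x \<in> V" "V \<subseteq> K"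
    using assms(1) unfolding locally_compact_space_def by simp metis
  have "emeasure \<mu> (V \<inter> U) \<le> emeasure \<mu> K"
    using V assms by (intro emeasure_mono) (auto simp: radon_measure_sets borel_closed compact_imp_closed)
  also have "\<dots> < \<infinity>"
    by (rule radon_measure_compact_finite) fact+
  finally show ?thesis
    using V assms by (intro exI[of _ "V \<inter> U"]) auto
qed

text \<open>
  The Borel \<open>\<sigma>\<close>-algebra of a product can be larger than the product \<open>\<sigma>\<close>-algebra, so an open set is
  exhausted by the directed family of finite unions of open rectangles of finite measure.
\<close>

lemma nn_integral_emeasure_section_le:
  fixes \<mu> :: "'a::t2_space measure" and \<nu> :: "'b::t2_space measure"
  assumes lc: "locally_compact_space (euclidean :: 'a topology)"
      "locally_compact_space (euclidean :: 'b topology)"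
    and \<mu>: "radon_measure \<mu>" and \<nu>: "radon_measure \<nu>" and W: "open W"
  shows "(\<integral>\<^sup>+z. emeasure \<mu> {y. (y, z) \<in> W} \<partial>\<nu>) \<le> (\<integral>\<^sup>+y. emeasure \<nu> {z. (y, z) \<in> W} \<partial>\<mu>)"
proof -
  note [simp] = radon_measure_sets[OF \<mu>] radon_measure_sets[OF \<nu>]
  define \<R> where "\<R> = {(U, V). open U \<and> open V \<and> emeasure \<mu> U < \<infinity> \<and> emeasure \<nu> V < \<infinity>
    \<and> U \<times> V \<subseteq> W}"
  define G where "G R = (\<Union>(U, V)\<in>R. U \<times> V)" for R :: "('a set \<times> 'b set) set"
  define \<phi> where "\<phi> R z = emeasure \<mu> {y. (y, z) \<in> G R}" for R z
  define \<Phi> where "\<Phi> = \<phi> ` {R. finite R \<and> R \<subseteq> \<R>}"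
  have oG: "open (G R)" if "R \<subseteq> \<R>" for R
    using that unfolding G_def \<R>_def by (auto intro!: open_Times)
  have mono: "\<phi> R \<le> \<phi> R'" if "R \<subseteq> R'" "R' \<subseteq> \<R>" for R R'
    unfolding \<phi>_def le_fun_def using that open_section(1)[OF oG[OF that(2)]]
    by (auto intro!: emeasure_mono simp: G_def)
  have "emeasure \<mu> {y. (y, z) \<in> W} \<le> (SUP f\<in>\<Phi>. f z)" for z
    unfolding radon_measure_open_SUP[OF \<mu> open_section(1)[OF W, of z]]
  proof (rule SUP_least)
    fix K assume "K \<in> {K. compact K \<and> K \<subseteq> {y. (y, z) \<in> W}}"
    then have K: "compact K" "K \<subseteq> {y. (y, z) \<in> W}"
      by auto
    \<comment> \<open>Local compactness enters here: each point of K \<times> {z} has a rectangle of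
      finite sides within W.\<close>
    have "\<exists>(U, V)\<in>\<R>. open U \<and> y \<in> U \<and> z \<in> V" if "y \<in> K" for y
    proof -
      have "(y, z) \<in> W"
        using K(2) that by auto
      then obtain A B where AB: "open A" "open B" "y \<in> A" "z \<in> B" "A \<times> B \<subseteq> W"
        using open_prod_rectangle[OF W] by metis
      obtain U where "open U" "y \<in> U" "U \<subseteq> A" "emeasure \<mu> U < \<infinity>"
        using locally_compact_finite_nbhd[OF lc(1) \<mu> AB(1,3)] by blast
      moreover obtain V where "open V" "z \<in> V" "V \<subseteq> B" "emeasure \<nu> V < \<infinity>"
        using locally_compact_finite_nbhd[OF lc(2) \<nu> AB(2,4)] by blast
      ultimately show ?thesis
        using AB(5) by (intro bexI[of _ "(U, V)"]) (auto simp: \<R>_def)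
    qed
    from compact_finite_rectangles[OF K(1) this]
    obtain R where R: "finite R" "R \<subseteq> \<R>" "\<forall>(U, V)\<in>R. z \<in> V" "K \<subseteq> (\<Union>(U, V)\<in>R. U)"
      by blast
    have "K \<subseteq> {y. (y, z) \<in> G R}"
    proof
      fix y assume "y \<in> K"
      then obtain p where "p \<in> R" "y \<in> fst p"
        using R(4) by (auto simp: case_prod_beta)
      moreover have "z \<in> snd p"
        using R(3) \<open>p \<in> R\<close> by auto
      ultimately show "y \<in> {y. (y, z) \<in> G R}"
        by (auto simp: G_def case_prod_beta)
    qed
    then have "emeasure \<mu> K \<le> \<phi> R z"
      unfolding \<phi>_def using open_section(1)[OF oG[OF R(2)], of z] by (intro emeasure_mono) simp_all
    also have "\<dots> \<le> (SUP f\<in>\<Phi>. f z)"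
      by (rule SUP_upper[of "\<phi> R" \<Phi> "\<lambda>f. f z"]) (use R in \<open>auto simp: \<Phi>_def\<close>)
    finally show "emeasure \<mu> K \<le> (SUP f\<in>\<Phi>. f z)" .
  qed
  then have "(\<integral>\<^sup>+z. emeasure \<mu> {y. (y, z) \<in> W} \<partial>\<nu>) \<le> (\<integral>\<^sup>+z. (SUP f\<in>\<Phi>. f z) \<partial>\<nu>)"
    by (rule nn_integral_mono)
  also have "\<dots> \<le> (SUP f\<in>\<Phi>. \<integral>\<^sup>+z. f z \<partial>\<nu>)"
  proof (rule nn_integral_directed_lsc_le[OF \<nu>])
    show "\<Phi> \<noteq> {}"
      by (auto simp: \<Phi>_def)
    show "\<exists>h\<in>\<Phi>. f \<le> h \<and> g \<le> h" if fg: "f \<in> \<Phi>" "g \<in> \<Phi>" for f g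
    proof -
      obtain R R' where R: "finite R" "R \<subseteq> \<R>" "f = \<phi> R" "finite R'" "R' \<subseteq> \<R>" "g = \<phi> R'"
        using fg by (auto simp: \<Phi>_def)
      then show ?thesis
        by (intro bexI[of _ "\<phi> (R \<union> R')"] conjI) (auto simp: \<Phi>_def intro!: mono)
    qed
    show "open {x. c < f x}" if "f \<in> \<Phi>" for f c
      using that open_emeasure_section_gt[OF \<mu> oG] by (auto simp: \<Phi>_def \<phi>_def)
  qed
  also have "\<dots> \<le> (\<integral>\<^sup>+y. emeasure \<nu> {z. (y, z) \<in> W} \<partial>\<mu>)"
  proof (rule SUP_least)
    fix f assume "f \<in> \<Phi>"
    then obtain R where R: "finite R" "R \<subseteq> \<R>" "f = \<phi> R"
      by (auto simp: \<Phi>_def)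
    have "(\<integral>\<^sup>+z. f z \<partial>\<nu>) = (\<integral>\<^sup>+y. emeasure \<nu> {z. (y, z) \<in> G R} \<partial>\<mu>)"
      unfolding R(3) \<phi>_def G_def
      by (rule nn_integral_section_finite_rectangles[OF \<mu> \<nu> R(1)]) (use R(2) in \<open>auto simp: \<R>_def\<close>)
    also have "\<dots> \<le> (\<integral>\<^sup>+y. emeasure \<nu> {z. (y, z) \<in> W} \<partial>\<mu>)"
    proof (intro nn_integral_mono emeasure_mono)
      have "G R \<subseteq> W"
        using R(2) unfolding G_def \<R>_def by blast
      then show "{z. (y, z) \<in> G R} \<subseteq> {z. (y, z) \<in> W}" for y
        by auto
    qed (use open_section(2)[OF W] in auto)
    finally show "(\<integral>\<^sup>+z. f z \<partial>\<nu>) \<le> (\<integral>\<^sup>+y. emeasure \<nu> {z. (y, z) \<in> W} \<partial>\<mu>)" .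
  qed
  finally show ?thesis .
qed

subsection \<open>Tonelli's inequality for convolutions\<close>

text \<open>Integration runs over the whole group; the restriction to the semigroup will be carried
  by functions that vanish off S.\<close>

definition nn_convolution ::
    "'a::group_add measure \<Rightarrow> ('a \<Rightarrow> ennreal) \<Rightarrow> ('a \<Rightarrow> ennreal) \<Rightarrow> 'a \<Rightarrow> ennreal" where
  "nn_convolution \<mu> A B z = (\<integral>\<^sup>+y. A y * B (- y + z) \<partial>\<mu>)"

text \<open>Stated as a cover, so that arbitrary subsets inherit the property and X itself may be
  non-measurable.\<close>

definition sigma_finite_on :: "'a measure \<Rightarrow> 'a set \<Rightarrow> bool" where
  "sigma_finite_on \<mu> X \<longleftrightarrow>
     (\<exists>E::nat \<Rightarrow> 'a set. (\<forall>n. E n \<in> sets \<mu> \<and> emeasure \<mu> (E n) < \<infinity>) \<and> X \<subseteq> (\<Union>n. E n))"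

lemma sigma_finite_on_subset: "sigma_finite_on \<mu> Y \<Longrightarrow> X \<subseteq> Y \<Longrightarrow> sigma_finite_on \<mu> X"
  unfolding sigma_finite_on_def by (meson subset_trans)

lemma sigma_finite_on_Un:
  assumes "sigma_finite_on \<mu> X" "sigma_finite_on \<mu> Y"
  shows "sigma_finite_on \<mu> (X \<union> Y)"
proof -
  obtain E F :: "nat \<Rightarrow> 'a set" where
    E: "\<And>n. E n \<in> sets \<mu>" "\<And>n. emeasure \<mu> (E n) < \<infinity>" "X \<subseteq> (\<Union>n. E n)" and
    F: "\<And>n. F n \<in> sets \<mu>" "\<And>n. emeasure \<mu> (F n) < \<infinity>" "Y \<subseteq> (\<Union>n. F n)"
    using assms unfolding sigma_finite_on_def by metis
  have "emeasure \<mu> (E n \<union> F n) < \<infinity>" for n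
    using emeasure_subadditive[OF E(1) F(1), of n n] E(2)[of n] F(2)[of n]
    by (auto simp: order.strict_trans1)
  then show ?thesis
    unfolding sigma_finite_on_def using E F by (intro exI[of _ "\<lambda>n. E n \<union> F n"]) fastforce
qed

lemma sigma_finite_on_null: "N \<in> null_sets \<mu> \<Longrightarrow> sigma_finite_on \<mu> N"
  unfolding sigma_finite_on_def by (intro exI[of _ "\<lambda>_. N"]) (auto simp: null_sets_def)

text \<open>By Markov's inequality each set {A \<ge> 1/(n+1)} has finite measure, and these sets
  exhaust the support.\<close>

lemma sigma_finite_on_support:
  assumes A[measurable]: "A \<in> borel_measurable \<mu>" and fin: "(\<integral>\<^sup>+x. A x \<partial>\<mu>) < \<infinity>"
  shows "sigma_finite_on \<mu> {x \<in> space \<mu>. A x \<noteq> 0}"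
  unfolding sigma_finite_on_def
proof (intro exI conjI allI)
  fix n :: nat
  let ?E = "{x \<in> space \<mu>. 1 \<le> of_nat (Suc n) * A x}"
  show "?E \<in> sets \<mu>"
    by measurable
  have "emeasure \<mu> ?E \<le> of_nat (Suc n) * (\<integral>\<^sup>+x. A x * indicator (space \<mu>) x \<partial>\<mu>)"
    by (rule nn_integral_Markov_inequality) auto
  also have "(\<integral>\<^sup>+x. A x * indicator (space \<mu>) x \<partial>\<mu>) = (\<integral>\<^sup>+x. A x \<partial>\<mu>)"
    by (intro nn_integral_cong) simp
  also have "of_nat (Suc n) * (\<integral>\<^sup>+x. A x \<partial>\<mu>) < \<infinity>"
    using fin by (simp add: ennreal_mult_less_top of_nat_less_top del: of_nat_Suc)
  finally show "emeasure \<mu> ?E < \<infinity>" .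
next
  show "{x \<in> space \<mu>. A x \<noteq> 0} \<subseteq> (\<Union>n. {x \<in> space \<mu>. 1 \<le> of_nat (Suc n) * A x})"
  proof clarify
    fix x assume x: "x \<in> space \<mu>" "A x \<noteq> 0"
    have "\<exists>n. 1 \<le> of_nat (Suc n) * A x"
    proof (cases "A x")
      case (real r)
      with x have "r > 0" by (auto simp: less_le)
      then obtain n where "1 / r < real n"
        using reals_Archimedean2 by blast
      then have "1 \<le> real (Suc n) * r"
        using \<open>r > 0\<close> by (simp add: field_simps)
      then have "ennreal 1 \<le> ennreal (real (Suc n) * r)"
        by (rule ennreal_leI)
      also have "\<dots> = of_nat (Suc n) * A x"
        using real by (subst ennreal_mult) (auto simp: ennreal_of_nat_eq_real_of_nat simp del: of_nat_Suc)
      finally show ?thesis by auto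
    next
      case top
      then show ?thesis by (intro exI[of _ 0]) auto
    qed
    then show "x \<in> (\<Union>n. {x \<in> space \<mu>. 1 \<le> of_nat (Suc n) * A x})"
      using x by auto
  qed
qed

locale locally_compact_haar =
  fixes \<mu> :: "'a::{topological_group_add, t2_space} measure"
  assumes locally_compact: "locally_compact_space (euclidean :: 'a topology)"
    and left_haar: "left_haar_measure \<mu>"
begin

lemma radon: "radon_measure \<mu>"
  using left_haar by (simp add: left_haar_measure_def)

lemma sets_haar [simp, measurable_cong]: "sets \<mu> = sets borel"
  using radon by (rule radon_measure_sets)

lemma space_haar [simp]: "space \<mu> = UNIV"
  using radon by (rule radon_measure_space)

lemma measurable_left_translation: "(\<lambda>y. x + y) \<in> borel_measurable borel" for x :: 'a
  by (intro borel_measurable_continuous_onI continuous_intros)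

lemma measurable_reflection: "(\<lambda>y. - y + z) \<in> borel_measurable borel" for z :: 'a
  by (intro borel_measurable_continuous_onI continuous_intros)

lemma reflected_section_sets:
  assumes "X \<in> sets borel" "Y \<in> sets borel"
  shows "{y \<in> X. - y + z \<in> Y} \<in> sets \<mu>"
proof -
  have "{y \<in> X. - y + z \<in> Y} = X \<inter> (\<lambda>y. - y + z) -` Y"
    by auto
  then show ?thesis
    using assms measurable_sets[OF measurable_reflection assms(2)] by simp
qed

lemma distr_left_translation: "distr \<mu> borel (\<lambda>y. x + y) = \<mu>"
proof (rule measure_eqI)
  fix E assume "E \<in> sets (distr \<mu> borel (\<lambda>y. x + y))"
  then have E: "E \<in> sets borel" by simp
  have "(\<lambda>y. x + y) -` E = (\<lambda>y. - x + y) ` E"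
    by (auto simp: image_iff add.assoc[symmetric] intro!: bexI[of _ "x + _"])
  then show "emeasure (distr \<mu> borel (\<lambda>y. x + y)) E = emeasure \<mu> E"
    using left_haar E measurable_left_translation[of x]
    by (subst emeasure_distr) (auto simp: left_haar_measure_def)
qed simp

lemma nn_integral_left_translation:
  assumes "f \<in> borel_measurable borel"
  shows "(\<integral>\<^sup>+y. f (x + y) \<partial>\<mu>) = (\<integral>\<^sup>+y. f y \<partial>\<mu>)"
proof -
  have "(\<integral>\<^sup>+y. f y \<partial>\<mu>) = (\<integral>\<^sup>+y. f y \<partial>distr \<mu> borel (\<lambda>y. x + y))"
    by (simp add: distr_left_translation)
  also have "\<dots> = (\<integral>\<^sup>+y. f (x + y) \<partial>\<mu>)"
    using assms measurable_left_translation[of x] by (intro nn_integral_distr) auto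
  finally show ?thesis ..
qed

lemma emeasure_left_translation:
  assumes "V \<in> sets borel"
  shows "emeasure \<mu> {z. - y + z \<in> V} = emeasure \<mu> V"
proof -
  have "{z. - y + z \<in> V} = (\<lambda>z. y + z) ` V"
    by (auto simp: image_iff add.assoc[symmetric] intro!: bexI[of _ "- y + _"])
  then show ?thesis
    using left_haar assms by (simp add: left_haar_measure_def)
qed

lemma conv_integrand_measurable:
  fixes A B :: "'a \<Rightarrow> ennreal"
  assumes [measurable]: "A \<in> borel_measurable borel" and B: "B \<in> borel_measurable borel"
  shows "(\<lambda>y. A y * B (- y + z)) \<in> borel_measurable borel"
proof -
  have [measurable]: "(\<lambda>y. B (- y + z)) \<in> borel_measurable borel"
    by (rule measurable_compose[OF measurable_reflection B])
  show ?thesis by measurable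
qed

lemma complex_conv_integrand_measurable:
  fixes f g :: "'a \<Rightarrow> complex"
  assumes [measurable]: "f \<in> borel_measurable borel" and g: "g \<in> borel_measurable borel"
  shows "(\<lambda>y. f y * g (- y + z)) \<in> borel_measurable borel"
proof -
  have [measurable]: "(\<lambda>y. g (- y + z)) \<in> borel_measurable borel"
    by (rule measurable_compose[OF measurable_reflection g])
  show ?thesis by measurable
qed

section \<open>Convolutions of indicators: from open sets to Borel sets of finite measure\<close>

lemma nn_convolution_indicator:
  assumes "E \<in> sets borel" "F \<in> sets borel"
  shows "nn_convolution \<mu> (indicator E) (indicator F) z = emeasure \<mu> {y \<in> E. - y + z \<in> F}"
proof -
  have [measurable]: "{y. - y + z \<in> F} \<in> sets borel"
    using measurable_sets[OF measurable_reflection assms(2)] by (simp add: vimage_def)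
  have "nn_convolution \<mu> (indicator E) (indicator F) z
      = (\<integral>\<^sup>+y. indicator (E \<inter> {y. - y + z \<in> F}) y \<partial>\<mu>)"
    unfolding nn_convolution_def by (intro nn_integral_cong) (auto simp: indicator_def)
  also have "\<dots> = emeasure \<mu> (E \<inter> {y. - y + z \<in> F})"
    using assms by (intro nn_integral_indicator) auto
  finally show ?thesis
    by (simp add: Int_def)
qed

text \<open>The pairs (y, z) with y in U and -y + z in V form an open set by continuity of the group
  operations. Its section at z is the set measured here, and its section at y in U is the left
  translate of V by y, of measure \<mu>(V).\<close>

lemma nn_convolution_open:
  assumes U: "open U" and V: "open V"
  shows "(\<lambda>z. emeasure \<mu> {y \<in> U. - y + z \<in> V}) \<in> borel_measurable borel" (is ?meas)
    and "(\<integral>\<^sup>+z. emeasure \<mu> {y \<in> U. - y + z \<in> V} \<partial>\<mu>) \<le> emeasure \<mu> U * emeasure \<mu> V" (is ?le)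
proof -
  define W where "W = (U \<times> UNIV) \<inter> (\<lambda>p. - fst p + snd p) -` V"
  have W: "open W"
    unfolding W_def using U V
    by (intro open_Int open_Times open_UNIV open_vimage continuous_intros) auto
  have s: "{y \<in> U. - y + z \<in> V} = {y. (y, z) \<in> W}" for z
    by (auto simp: W_def)
  show ?meas
    unfolding s by (rule borel_measurable_emeasure_section[OF radon W])
  have "(\<integral>\<^sup>+z. emeasure \<mu> {y \<in> U. - y + z \<in> V} \<partial>\<mu>) \<le> (\<integral>\<^sup>+y. emeasure \<mu> {z. (y, z) \<in> W} \<partial>\<mu>)"
    unfolding s by (intro nn_integral_emeasure_section_le locally_compact radon W)
  also have "\<dots> = (\<integral>\<^sup>+y. emeasure \<mu> V * indicator U y \<partial>\<mu>)"
  proof (intro nn_integral_cong)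
    fix y
    have "{z. (y, z) \<in> W} = (if y \<in> U then {z. - y + z \<in> V} else {})"
      by (auto simp: W_def)
    then show "emeasure \<mu> {z. (y, z) \<in> W} = emeasure \<mu> V * indicator U y"
      using emeasure_left_translation[of V y] V by auto
  qed
  also have "\<dots> = emeasure \<mu> U * emeasure \<mu> V"
    using U by (subst nn_integral_cmult_indicator) (auto simp: mult.commute)
  finally show ?le .
qed

lemma outer_approximation:
  assumes E: "E \<in> sets borel" "emeasure \<mu> E < \<infinity>"
  obtains U :: "nat \<Rightarrow> 'a set" where
    "\<And>n. open (U n)" "\<And>n. E \<subseteq> U n" "decseq U" "\<And>n. emeasure \<mu> (U n) < \<infinity>"
    "(\<lambda>n. emeasure \<mu> (U n)) \<longlonglongrightarrow> emeasure \<mu> E" "emeasure \<mu> ((\<Inter>n. U n) - E) = 0"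
proof -
  have INF: "emeasure \<mu> E = (INF U\<in>{U. open U \<and> E \<subseteq> U}. emeasure \<mu> U)"
    using conjunct1[OF conjunct2[OF conjunct2[OF radon[unfolded radon_measure_def]]]] E(1)
    by (rule bspec)
  have "emeasure \<mu> ` {U. open U \<and> E \<subseteq> U} \<noteq> {}"
    by auto
  from ennreal_Inf_countable_INF[OF this]
  obtain f :: "nat \<Rightarrow> ennreal"
    where f: "range f \<subseteq> emeasure \<mu> ` {U. open U \<and> E \<subseteq> U}" "emeasure \<mu> E = (INF i. f i)"
    using INF by auto
  have "\<exists>U. open U \<and> E \<subseteq> U \<and> f n = emeasure \<mu> U" for n
    using f(1) by blast
  then obtain V where V: "\<And>n. open (V n)" "\<And>n. E \<subseteq> V n" "\<And>n. f n = emeasure \<mu> (V n)"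
    by metis
  obtain m where m: "emeasure \<mu> (V m) < \<infinity>"
    using E(2) unfolding f(2) V(3) by (auto simp: INF_less_iff)
  \<comment> \<open>Intersecting everything with the one set \<open>V m\<close> of finite measure
    permits continuity from above along the decreasing sequence.\<close>
  define U where "U n = V m \<inter> (\<Inter>i\<le>n. V i)" for n
  have U: "open (U n)" "E \<subseteq> U n" for n
    using V by (auto simp: U_def)
  have dec: "decseq U"
    by (auto simp: decseq_def U_def)
  have "emeasure \<mu> (U n) \<le> emeasure \<mu> (V m)" for n
    using V by (intro emeasure_mono) (auto simp: U_def)
  then have fin: "emeasure \<mu> (U n) < \<infinity>" for n
    using m by (rule le_less_trans)
  have Ub: "range U \<subseteq> sets \<mu>"
    using U(1) by auto
  then have Ib: "(\<Inter>n. U n) \<in> sets \<mu>"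
    by auto
  have lim: "(\<lambda>n. emeasure \<mu> (U n)) \<longlonglongrightarrow> emeasure \<mu> (\<Inter>n. U n)"
    using fin by (intro Lim_emeasure_decseq[OF Ub dec]) (auto simp: less_top)
  have "emeasure \<mu> (\<Inter>n. U n) \<le> emeasure \<mu> E"
    unfolding f(2) V(3)
  proof (rule INF_greatest)
    fix n
    show "emeasure \<mu> (\<Inter>n. U n) \<le> emeasure \<mu> (V n)"
      using V(1) by (intro emeasure_mono) (auto simp: U_def)
  qed
  moreover have "emeasure \<mu> E \<le> emeasure \<mu> (\<Inter>n. U n)"
    using U(2) Ib by (intro emeasure_mono) auto
  ultimately have eq: "emeasure \<mu> (\<Inter>n. U n) = emeasure \<mu> E"
    by (rule antisym)
  have "emeasure \<mu> ((\<Inter>n. U n) - E) = emeasure \<mu> (\<Inter>n. U n) - emeasure \<mu> E"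
    using E U(2) Ib by (intro emeasure_Diff) (auto simp: less_top)
  then have "emeasure \<mu> ((\<Inter>n. U n) - E) = 0"
    using eq E(2) by (simp add: ennreal_minus_eq_0)
  then show thesis
    using that[OF U dec fin] lim eq by simp
qed

text \<open>The hulls are countable intersections of open sets, so their convolution is an infimum
  of a sequence of section measures of open sets and is genuinely Borel, which is not clear for E
  and F themselves. The bound is the limit of the products for the open sets.\<close>

lemma borel_hull:
  assumes E: "E \<in> sets borel" "emeasure \<mu> E < \<infinity>" and F: "F \<in> sets borel" "emeasure \<mu> F < \<infinity>"
  obtains G H where
    "G \<in> sets borel" "H \<in> sets borel" "E \<subseteq> G" "F \<subseteq> H"
    "emeasure \<mu> (G - E) = 0" "emeasure \<mu> (H - F) = 0"
    "(\<lambda>z. emeasure \<mu> {y \<in> G. - y + z \<in> H}) \<in> borel_measurable borel"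
    "(\<integral>\<^sup>+z. emeasure \<mu> {y \<in> G. - y + z \<in> H} \<partial>\<mu>) \<le> emeasure \<mu> E * emeasure \<mu> F"
proof -
  obtain U where U: "\<And>n. open (U n)" "\<And>n. E \<subseteq> U n" "decseq U" "\<And>n. emeasure \<mu> (U n) < \<infinity>"
    "(\<lambda>n. emeasure \<mu> (U n)) \<longlonglongrightarrow> emeasure \<mu> E" "emeasure \<mu> ((\<Inter>n. U n) - E) = 0"
    using outer_approximation[OF E] by metis
  obtain V where V: "\<And>n. open (V n)" "\<And>n. F \<subseteq> V n" "decseq V" "\<And>n. emeasure \<mu> (V n) < \<infinity>"
    "(\<lambda>n. emeasure \<mu> (V n)) \<longlonglongrightarrow> emeasure \<mu> F" "emeasure \<mu> ((\<Inter>n. V n) - F) = 0"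
    using outer_approximation[OF F] by metis
  define G where "G = (\<Inter>n. U n)"
  define H where "H = (\<Inter>n. V n)"
  have GH: "G \<in> sets borel" "H \<in> sets borel"
    using U(1) V(1) by (auto simp: G_def H_def)
  have eq: "emeasure \<mu> {y \<in> G. - y + z \<in> H} = (INF n. emeasure \<mu> {y \<in> U n. - y + z \<in> V n})" for z
  proof -
    have "emeasure \<mu> {y \<in> U n. - y + z \<in> V n} < \<infinity>" for n
      using U(1) by (intro le_less_trans[OF emeasure_mono U(4)[of n]]) auto
    then have "(INF n. emeasure \<mu> {y \<in> U n. - y + z \<in> V n})
        = emeasure \<mu> (\<Inter>n. {y \<in> U n. - y + z \<in> V n})"
    proof (intro INF_emeasure_decseq)
      show "range (\<lambda>n. {y \<in> U n. - y + z \<in> V n}) \<subseteq> sets \<mu>"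
        using reflected_section_sets[OF borel_open[OF U(1)] borel_open[OF V(1)]] by auto
      show "decseq (\<lambda>n. {y \<in> U n. - y + z \<in> V n})"
      proof (rule decseq_SucI, clarify)
        fix n y assume "y \<in> U (Suc n)" "- y + z \<in> V (Suc n)"
        then show "y \<in> U n \<and> - y + z \<in> V n"
          using decseq_SucD[OF U(3), of n] decseq_SucD[OF V(3), of n] by auto
      qed
    qed (auto simp: less_top)
    moreover have "(\<Inter>n. {y \<in> U n. - y + z \<in> V n}) = {y \<in> G. - y + z \<in> H}"
      by (auto simp: G_def H_def)
    ultimately show ?thesis by simp
  qed
  have meas: "(\<lambda>z. emeasure \<mu> {y \<in> G. - y + z \<in> H}) \<in> borel_measurable borel"
    unfolding eq using nn_convolution_open(1)[OF U(1) V(1)] by (intro borel_measurable_INF) auto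
  have "(\<lambda>n. emeasure \<mu> (U n) * emeasure \<mu> (V n)) \<longlonglongrightarrow> emeasure \<mu> E * emeasure \<mu> F"
    using U(5) V(5) E(2) F(2) by (intro tendsto_mult_ennreal) auto
  moreover have "(\<integral>\<^sup>+z. emeasure \<mu> {y \<in> G. - y + z \<in> H} \<partial>\<mu>) \<le> emeasure \<mu> (U n) * emeasure \<mu> (V n)" for n
  proof -
    have "(\<integral>\<^sup>+z. emeasure \<mu> {y \<in> G. - y + z \<in> H} \<partial>\<mu>)
        \<le> (\<integral>\<^sup>+z. emeasure \<mu> {y \<in> U n. - y + z \<in> V n} \<partial>\<mu>)"
      unfolding eq by (intro nn_integral_mono INF_lower) auto
    also have "\<dots> \<le> emeasure \<mu> (U n) * emeasure \<mu> (V n)"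
      by (rule nn_convolution_open(2)[OF U(1) V(1)])
    finally show ?thesis .
  qed
  ultimately have "(\<integral>\<^sup>+z. emeasure \<mu> {y \<in> G. - y + z \<in> H} \<partial>\<mu>) \<le> emeasure \<mu> E * emeasure \<mu> F"
    by (intro LIMSEQ_le_const) auto
  then show thesis
    using that[of G H] GH meas U(2,6) V(2,6) by (auto simp: G_def H_def)
qed

text \<open>The convolution of the hulls is Borel with integral at most 0, hence zero almost
  everywhere; the smaller sets inherit this by monotonicity at each z.\<close>

lemma nn_convolution_null:
  assumes E: "E \<in> sets borel" "emeasure \<mu> E < \<infinity>" and F: "F \<in> sets borel" "emeasure \<mu> F < \<infinity>"
    and "emeasure \<mu> E = 0 \<or> emeasure \<mu> F = 0"
  shows "AE z in \<mu>. emeasure \<mu> {y \<in> E. - y + z \<in> F} = 0"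
proof -
  obtain G H where GH: "G \<in> sets borel" "H \<in> sets borel" "E \<subseteq> G" "F \<subseteq> H"
    and "emeasure \<mu> (G - E) = 0" "emeasure \<mu> (H - F) = 0"
    and m: "(\<lambda>z. emeasure \<mu> {y \<in> G. - y + z \<in> H}) \<in> borel_measurable borel"
    and le: "(\<integral>\<^sup>+z. emeasure \<mu> {y \<in> G. - y + z \<in> H} \<partial>\<mu>) \<le> emeasure \<mu> E * emeasure \<mu> F"
    by (rule borel_hull[OF E F])
  have "(\<integral>\<^sup>+z. emeasure \<mu> {y \<in> G. - y + z \<in> H} \<partial>\<mu>) = 0"
    using le assms(5) by auto
  then have "AE z in \<mu>. emeasure \<mu> {y \<in> G. - y + z \<in> H} = 0"
    using m by (subst (asm) nn_integral_0_iff_AE) auto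
  then show ?thesis
  proof eventually_elim
    case (elim z)
    have "{y \<in> G. - y + z \<in> H} \<in> sets \<mu>"
      by (rule reflected_section_sets[OF GH(1,2)])
    then have "emeasure \<mu> {y \<in> E. - y + z \<in> F} \<le> emeasure \<mu> {y \<in> G. - y + z \<in> H}"
      using GH by (intro emeasure_mono) auto
    then show ?case
      using elim by simp
  qed
qed

text \<open>
  The integrand is measurable only for the Borel sets of the product, and \<open>\<mu>\<close> may fail to be \<open>\<sigma>\<close>-finite, so measurability of the convolution is part of
  the claim and holds up to a null set.
\<close>

definition tonelli :: "('a \<Rightarrow> ennreal) \<Rightarrow> ('a \<Rightarrow> ennreal) \<Rightarrow> bool" where
  "tonelli A B \<longleftrightarrow>
     (\<exists>h\<in>borel_measurable borel. (AE z in \<mu>. nn_convolution \<mu> A B z = h z) \<and>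
        (\<integral>\<^sup>+z. h z \<partial>\<mu>) \<le> (\<integral>\<^sup>+y. A y \<partial>\<mu>) * (\<integral>\<^sup>+y. B y \<partial>\<mu>))"

text \<open>The convolution of the hulls is the required Borel version: G \<times> H exceeds E
  \<times> F only by (G - E) \<times> H and E \<times> (H - F), and each of these contributes zero
  for almost every z by \<open>nn_convolution_null\<close>.\<close>

lemma tonelli_indicator:
  assumes E: "E \<in> sets borel" "emeasure \<mu> E < \<infinity>" and F: "F \<in> sets borel" "emeasure \<mu> F < \<infinity>"
  shows "tonelli (indicator E) (indicator F)"
proof -
  obtain G H where GH: "G \<in> sets borel" "H \<in> sets borel" "E \<subseteq> G" "F \<subseteq> H"
    and null: "emeasure \<mu> (G - E) = 0" "emeasure \<mu> (H - F) = 0"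
    and m: "(\<lambda>z. emeasure \<mu> {y \<in> G. - y + z \<in> H}) \<in> borel_measurable borel"
    and le: "(\<integral>\<^sup>+z. emeasure \<mu> {y \<in> G. - y + z \<in> H} \<partial>\<mu>) \<le> emeasure \<mu> E * emeasure \<mu> F"
    by (rule borel_hull[OF E F])
  have fH: "emeasure \<mu> H < \<infinity>"
  proof -
    have "emeasure \<mu> H \<le> emeasure \<mu> F + emeasure \<mu> (H - F)"
      using GH F emeasure_subadditive[of F \<mu> "H - F"] by (simp add: Un_absorb1)
    then show ?thesis
      using null F by (auto simp: less_top)
  qed
  have "AE z in \<mu>. emeasure \<mu> {y \<in> G - E. - y + z \<in> H} = 0"
    using GH null E fH by (intro nn_convolution_null) auto
  moreover have "AE z in \<mu>. emeasure \<mu> {y \<in> E. - y + z \<in> H - F} = 0"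
    using GH null E F by (intro nn_convolution_null) auto
  ultimately have "AE z in \<mu>. nn_convolution \<mu> (indicator E) (indicator F) z
      = emeasure \<mu> {y \<in> G. - y + z \<in> H}"
  proof eventually_elim
    case (elim z)
    have "emeasure \<mu> {y \<in> G. - y + z \<in> H} = emeasure \<mu> {y \<in> E. - y + z \<in> F}"
    proof (rule antisym)
      have "{y \<in> G. - y + z \<in> H} \<subseteq>
          {y \<in> E. - y + z \<in> F} \<union> ({y \<in> G - E. - y + z \<in> H} \<union> {y \<in> E. - y + z \<in> H - F})"
        by auto
      then have "emeasure \<mu> {y \<in> G. - y + z \<in> H} \<le> emeasure \<mu>
          ({y \<in> E. - y + z \<in> F} \<union> ({y \<in> G - E. - y + z \<in> H} \<union> {y \<in> E. - y + z \<in> H - F}))"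
        using reflected_section_sets GH E F by (intro emeasure_mono) (auto intro!: sets.Un)
      also have "\<dots> \<le> emeasure \<mu> {y \<in> E. - y + z \<in> F} +
          (emeasure \<mu> {y \<in> G - E. - y + z \<in> H} + emeasure \<mu> {y \<in> E. - y + z \<in> H - F})"
        using reflected_section_sets GH E F
        by (intro order_trans[OF emeasure_subadditive] add_left_mono emeasure_subadditive sets.Un) auto
      finally show "emeasure \<mu> {y \<in> G. - y + z \<in> H} \<le> emeasure \<mu> {y \<in> E. - y + z \<in> F}"
        using elim by simp
      show "emeasure \<mu> {y \<in> E. - y + z \<in> F} \<le> emeasure \<mu> {y \<in> G. - y + z \<in> H}"
        using reflected_section_sets GH by (intro emeasure_mono) auto
    qed
    then show ?case
      using E F by (simp add: nn_convolution_indicator)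
  qed
  then show ?thesis
    unfolding tonelli_def using m le E F by (intro bexI[of _ "\<lambda>z. emeasure \<mu> {y \<in> G. - y + z \<in> H}"]) auto
qed

section \<open>Extension of Tonelli's inequality from indicators to functions\<close>

lemma tonelli_add:
  assumes "tonelli A1 B1" "tonelli A2 B2"
    and conv: "\<And>z. nn_convolution \<mu> A B z = nn_convolution \<mu> A1 B1 z + nn_convolution \<mu> A2 B2 z"
    and int: "(\<integral>\<^sup>+y. A1 y \<partial>\<mu>) * (\<integral>\<^sup>+y. B1 y \<partial>\<mu>) + (\<integral>\<^sup>+y. A2 y \<partial>\<mu>) * (\<integral>\<^sup>+y. B2 y \<partial>\<mu>)
      \<le> (\<integral>\<^sup>+y. A y \<partial>\<mu>) * (\<integral>\<^sup>+y. B y \<partial>\<mu>)"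
  shows "tonelli A B"
proof -
  obtain h1 where h1[measurable]: "h1 \<in> borel_measurable borel"
    and e1: "AE z in \<mu>. nn_convolution \<mu> A1 B1 z = h1 z"
    and l1: "(\<integral>\<^sup>+z. h1 z \<partial>\<mu>) \<le> (\<integral>\<^sup>+y. A1 y \<partial>\<mu>) * (\<integral>\<^sup>+y. B1 y \<partial>\<mu>)"
    using assms(1) unfolding tonelli_def by auto
  obtain h2 where h2[measurable]: "h2 \<in> borel_measurable borel"
    and e2: "AE z in \<mu>. nn_convolution \<mu> A2 B2 z = h2 z"
    and l2: "(\<integral>\<^sup>+z. h2 z \<partial>\<mu>) \<le> (\<integral>\<^sup>+y. A2 y \<partial>\<mu>) * (\<integral>\<^sup>+y. B2 y \<partial>\<mu>)"
    using assms(2) unfolding tonelli_def by auto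
  show ?thesis
    unfolding tonelli_def
  proof (intro bexI[of _ "\<lambda>z. h1 z + h2 z"] conjI)
    show "AE z in \<mu>. nn_convolution \<mu> A B z = h1 z + h2 z"
      using e1 e2 by eventually_elim (simp add: conv)
    have "(\<integral>\<^sup>+z. h1 z + h2 z \<partial>\<mu>) = (\<integral>\<^sup>+z. h1 z \<partial>\<mu>) + (\<integral>\<^sup>+z. h2 z \<partial>\<mu>)"
      by (intro nn_integral_add) auto
    also have "\<dots> \<le> (\<integral>\<^sup>+y. A1 y \<partial>\<mu>) * (\<integral>\<^sup>+y. B1 y \<partial>\<mu>) + (\<integral>\<^sup>+y. A2 y \<partial>\<mu>) * (\<integral>\<^sup>+y. B2 y \<partial>\<mu>)"
      using l1 l2 by (rule add_mono)
    finally show "(\<integral>\<^sup>+z. h1 z + h2 z \<partial>\<mu>) \<le> (\<integral>\<^sup>+y. A y \<partial>\<mu>) * (\<integral>\<^sup>+y. B y \<partial>\<mu>)"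
      using int by (rule order_trans)
  qed measurable
qed

text \<open>As in \<open>tonelli_add\<close>, bilinearity enters only through \<open>conv\<close>
  and \<open>int\<close>, so that each rule serves for the left and for the right factor.\<close>

lemma tonelli_cmult:
  assumes "tonelli A1 B1"
    and conv: "\<And>z. nn_convolution \<mu> A B z = c * nn_convolution \<mu> A1 B1 z"
    and int: "c * ((\<integral>\<^sup>+y. A1 y \<partial>\<mu>) * (\<integral>\<^sup>+y. B1 y \<partial>\<mu>)) \<le> (\<integral>\<^sup>+y. A y \<partial>\<mu>) * (\<integral>\<^sup>+y. B y \<partial>\<mu>)"
  shows "tonelli A B"
proof -
  obtain h where h[measurable]: "h \<in> borel_measurable borel"
    and e: "AE z in \<mu>. nn_convolution \<mu> A1 B1 z = h z"
    and l: "(\<integral>\<^sup>+z. h z \<partial>\<mu>) \<le> (\<integral>\<^sup>+y. A1 y \<partial>\<mu>) * (\<integral>\<^sup>+y. B1 y \<partial>\<mu>)"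
    using assms(1) unfolding tonelli_def by auto
  show ?thesis
    unfolding tonelli_def
  proof (intro bexI[of _ "\<lambda>z. c * h z"] conjI)
    show "AE z in \<mu>. nn_convolution \<mu> A B z = c * h z"
      using e by eventually_elim (simp add: conv)
    have "(\<integral>\<^sup>+z. c * h z \<partial>\<mu>) = c * (\<integral>\<^sup>+z. h z \<partial>\<mu>)"
      by (intro nn_integral_cmult) auto
    also have "\<dots> \<le> c * ((\<integral>\<^sup>+y. A1 y \<partial>\<mu>) * (\<integral>\<^sup>+y. B1 y \<partial>\<mu>))"
      using l by (rule mult_left_mono) simp
    finally show "(\<integral>\<^sup>+z. c * h z \<partial>\<mu>) \<le> (\<integral>\<^sup>+y. A y \<partial>\<mu>) * (\<integral>\<^sup>+y. B y \<partial>\<mu>)"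
      using int by (rule order_trans)
  qed measurable
qed

text \<open>The Borel versions of the approximations increase only almost everywhere, because they
  equal the convolutions only there; hence the almost-everywhere form of monotone
  convergence.\<close>

lemma tonelli_SUP:
  fixes A' B' :: "nat \<Rightarrow> 'a \<Rightarrow> ennreal"
  assumes ton: "\<And>i. tonelli (A' i) (B' i)"
    and conv: "\<And>z. nn_convolution \<mu> A B z = (SUP i. nn_convolution \<mu> (A' i) (B' i) z)"
    and inc: "incseq A'" "incseq B'" "\<And>i. A' i \<le> A" "\<And>i. B' i \<le> B"
  shows "tonelli A B"
proof -
  have "\<exists>h. h \<in> borel_measurable borel \<and> (AE z in \<mu>. nn_convolution \<mu> (A' i) (B' i) z = h z) \<and>
      (\<integral>\<^sup>+z. h z \<partial>\<mu>) \<le> (\<integral>\<^sup>+y. A' i y \<partial>\<mu>) * (\<integral>\<^sup>+y. B' i y \<partial>\<mu>)" for i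
    using ton[of i] unfolding tonelli_def by auto
  then obtain h where h[measurable]: "\<And>i. h i \<in> borel_measurable borel"
    and e: "\<And>i. AE z in \<mu>. nn_convolution \<mu> (A' i) (B' i) z = h i z"
    and l: "\<And>i. (\<integral>\<^sup>+z. h i z \<partial>\<mu>) \<le> (\<integral>\<^sup>+y. A' i y \<partial>\<mu>) * (\<integral>\<^sup>+y. B' i y \<partial>\<mu>)"
    by metis
  have e_all: "AE z in \<mu>. \<forall>i. nn_convolution \<mu> (A' i) (B' i) z = h i z"
    using e by (simp add: AE_all_countable)
  show ?thesis
    unfolding tonelli_def
  proof (intro bexI[of _ "\<lambda>z. SUP i. h i z"] conjI)
    show "AE z in \<mu>. nn_convolution \<mu> A B z = (SUP i. h i z)"
      using e_all by eventually_elim (simp add: conv)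
    have "(\<integral>\<^sup>+z. (SUP i. h i z) \<partial>\<mu>) = (SUP i. \<integral>\<^sup>+z. h i z \<partial>\<mu>)"
    proof (rule nn_integral_monotone_convergence_SUP_AE)
      show "AE z in \<mu>. h i z \<le> h (Suc i) z" for i
        using e_all
      proof eventually_elim
        case (elim z)
        have "nn_convolution \<mu> (A' i) (B' i) z \<le> nn_convolution \<mu> (A' (Suc i)) (B' (Suc i)) z"
          unfolding nn_convolution_def using incseq_SucD[OF inc(1), of i] incseq_SucD[OF inc(2), of i]
          by (intro nn_integral_mono mult_mono) (auto simp: le_fun_def)
        then show ?case
          using elim by simp
      qed
    qed simp
    also have "\<dots> \<le> (\<integral>\<^sup>+y. A y \<partial>\<mu>) * (\<integral>\<^sup>+y. B y \<partial>\<mu>)"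
    proof (rule SUP_least)
      fix i
      have "(\<integral>\<^sup>+y. A' i y \<partial>\<mu>) * (\<integral>\<^sup>+y. B' i y \<partial>\<mu>) \<le> (\<integral>\<^sup>+y. A y \<partial>\<mu>) * (\<integral>\<^sup>+y. B y \<partial>\<mu>)"
        using inc(3)[of i] inc(4)[of i]
        by (intro mult_mono nn_integral_mono) (auto simp: le_fun_def)
      with l[of i] show "(\<integral>\<^sup>+z. h i z \<partial>\<mu>) \<le> (\<integral>\<^sup>+y. A y \<partial>\<mu>) * (\<integral>\<^sup>+y. B y \<partial>\<mu>)"
        by (rule order_trans)
    qed
    finally show "(\<integral>\<^sup>+z. (SUP i. h i z) \<partial>\<mu>) \<le> (\<integral>\<^sup>+y. A y \<partial>\<mu>) * (\<integral>\<^sup>+y. B y \<partial>\<mu>)" .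
  qed measurable
qed

lemma nn_convolution_SUP_left:
  fixes A' :: "nat \<Rightarrow> 'a \<Rightarrow> ennreal"
  assumes "\<And>i. A' i \<in> borel_measurable borel" "B \<in> borel_measurable borel" "incseq A'"
  shows "nn_convolution \<mu> (\<lambda>y. SUP i. A' i y) B z = (SUP i. nn_convolution \<mu> (A' i) B z)"
  unfolding nn_convolution_def SUP_mult_right_ennreal
proof (rule nn_integral_monotone_convergence_SUP)
  show "incseq (\<lambda>i y. A' i y * B (- y + z))"
    using assms(3) by (auto simp: incseq_def le_fun_def intro!: mult_right_mono)
  show "(\<lambda>y. A' i y * B (- y + z)) \<in> borel_measurable \<mu>" for i
    using conv_integrand_measurable[OF assms(1,2)] by simp
qed

lemma nn_convolution_SUP_right:
  fixes B' :: "nat \<Rightarrow> 'a \<Rightarrow> ennreal"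
  assumes "A \<in> borel_measurable borel" "\<And>i. B' i \<in> borel_measurable borel" "incseq B'"
  shows "nn_convolution \<mu> A (\<lambda>y. SUP i. B' i y) z = (SUP i. nn_convolution \<mu> A (B' i) z)"
  unfolding nn_convolution_def SUP_mult_left_ennreal
proof (rule nn_integral_monotone_convergence_SUP)
  show "incseq (\<lambda>i y. A y * B' i (- y + z))"
    using assms(3) by (auto simp: incseq_def le_fun_def intro!: mult_left_mono)
  show "(\<lambda>y. A y * B' i (- y + z)) \<in> borel_measurable \<mu>" for i
    using conv_integrand_measurable[OF assms(1,2)] by simp
qed

text \<open>Induction over measurable functions meets every Borel set, including those of infinite
  measure. The factor \<open>indicator E0\<close> is carried along to replace each of them by its
  intersection with E0, where \<open>ind\<close> applies.\<close>

lemma tonelli_left_induct: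
  assumes A: "A \<in> borel_measurable borel" and B: "B \<in> borel_measurable borel"
    and E0: "E0 \<in> sets borel"
    and ind: "\<And>E. E \<in> sets borel \<Longrightarrow> E \<subseteq> E0 \<Longrightarrow> tonelli (indicator E) B"
  shows "tonelli (\<lambda>y. A y * indicator E0 y) B"
  using A
proof (induction A rule: borel_measurable_induct)
  case (cong f g)
  then have "f = g" by auto
  with cong show ?case by simp
next
  case (set E)
  have "(\<lambda>y. indicator E y * indicator E0 y :: ennreal) = indicator (E \<inter> E0)"
    by (auto simp: indicator_def)
  then show ?case
    using ind[of "E \<inter> E0"] set E0 by simp
next
  case (mult u c)
  have m: "(\<lambda>y. u y * indicator E0 y) \<in> borel_measurable borel"
    using mult E0 by measurable
  show ?case
  proof (rule tonelli_cmult[OF mult(4), of _ _ c])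
    show "nn_convolution \<mu> (\<lambda>y. c * u y * indicator E0 y) B z
        = c * nn_convolution \<mu> (\<lambda>y. u y * indicator E0 y) B z" for z
      unfolding nn_convolution_def using conv_integrand_measurable[OF m B]
      by (subst nn_integral_cmult[symmetric]) (auto simp: mult.assoc)
    show "c * ((\<integral>\<^sup>+y. u y * indicator E0 y \<partial>\<mu>) * (\<integral>\<^sup>+y. B y \<partial>\<mu>))
        \<le> (\<integral>\<^sup>+y. c * u y * indicator E0 y \<partial>\<mu>) * (\<integral>\<^sup>+y. B y \<partial>\<mu>)"
      using m by (simp add: mult.assoc nn_integral_cmult)
  qed
next
  case (add u v)
  have m: "(\<lambda>y. u y * indicator E0 y) \<in> borel_measurable borel"
    "(\<lambda>y. v y * indicator E0 y) \<in> borel_measurable borel"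
    using add E0 by measurable
  show ?case
  proof (rule tonelli_add[OF add(7,6)])
    show "nn_convolution \<mu> (\<lambda>y. (v y + u y) * indicator E0 y) B z
        = nn_convolution \<mu> (\<lambda>y. v y * indicator E0 y) B z
          + nn_convolution \<mu> (\<lambda>y. u y * indicator E0 y) B z" for z
      unfolding nn_convolution_def
      using conv_integrand_measurable[OF m(1) B] conv_integrand_measurable[OF m(2) B]
      by (subst nn_integral_add[symmetric]) (auto simp: distrib_right)
    show "(\<integral>\<^sup>+y. v y * indicator E0 y \<partial>\<mu>) * (\<integral>\<^sup>+y. B y \<partial>\<mu>)
        + (\<integral>\<^sup>+y. u y * indicator E0 y \<partial>\<mu>) * (\<integral>\<^sup>+y. B y \<partial>\<mu>)
        \<le> (\<integral>\<^sup>+y. (v y + u y) * indicator E0 y \<partial>\<mu>) * (\<integral>\<^sup>+y. B y \<partial>\<mu>)"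
      using m by (simp add: distrib_right nn_integral_add)
  qed
next
  case (seq U)
  have eq: "(\<lambda>y. (SUP i. U i) y * indicator E0 y) = (\<lambda>y. SUP i. U i y * indicator E0 y)"
    by (simp add: SUP_mult_right_ennreal image_comp)
  have m: "(\<lambda>y. U i y * indicator E0 y) \<in> borel_measurable borel" for i
    using seq(1)[of i] E0 by measurable
  have inc: "incseq (\<lambda>i y. U i y * indicator E0 y)"
    using seq(3) by (auto simp: incseq_def le_fun_def intro!: mult_right_mono)
  show ?case
    unfolding eq
  proof (rule tonelli_SUP[OF seq(5)])
    show "nn_convolution \<mu> (\<lambda>y. SUP i. U i y * indicator E0 y) B z
        = (SUP i. nn_convolution \<mu> (\<lambda>y. U i y * indicator E0 y) B z)" for z
      by (rule nn_convolution_SUP_left[OF m B inc])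
    show "(\<lambda>y. U i y * indicator E0 y) \<le> (\<lambda>y. SUP i. U i y * indicator E0 y)" for i
      by (auto simp: le_fun_def intro: SUP_upper)
  qed (use inc in \<open>auto simp: incseq_def\<close>)
qed

lemma tonelli_right_induct:
  assumes A: "A \<in> borel_measurable borel" and B: "B \<in> borel_measurable borel"
    and E0: "E0 \<in> sets borel"
    and ind: "\<And>E. E \<in> sets borel \<Longrightarrow> E \<subseteq> E0 \<Longrightarrow> tonelli A (indicator E)"
  shows "tonelli A (\<lambda>y. B y * indicator E0 y)"
  using B
proof (induction B rule: borel_measurable_induct)
  case (cong f g)
  then have "f = g" by auto
  with cong show ?case by simp
next
  case (set E)
  have "(\<lambda>y. indicator E y * indicator E0 y :: ennreal) = indicator (E \<inter> E0)"
    by (auto simp: indicator_def)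
  then show ?case
    using ind[of "E \<inter> E0"] set E0 by simp
next
  case (mult u c)
  have m: "(\<lambda>y. u y * indicator E0 y) \<in> borel_measurable borel"
    using mult E0 by measurable
  show ?case
  proof (rule tonelli_cmult[OF mult(4), of _ _ c])
    show "nn_convolution \<mu> A (\<lambda>y. c * u y * indicator E0 y) z
        = c * nn_convolution \<mu> A (\<lambda>y. u y * indicator E0 y) z" for z
      unfolding nn_convolution_def using conv_integrand_measurable[OF A m]
      by (subst nn_integral_cmult[symmetric]) (auto simp: mult_ac)
    show "c * ((\<integral>\<^sup>+y. A y \<partial>\<mu>) * (\<integral>\<^sup>+y. u y * indicator E0 y \<partial>\<mu>))
        \<le> (\<integral>\<^sup>+y. A y \<partial>\<mu>) * (\<integral>\<^sup>+y. c * u y * indicator E0 y \<partial>\<mu>)"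
      using m by (simp add: mult.assoc nn_integral_cmult mult.left_commute)
  qed
next
  case (add u v)
  have m: "(\<lambda>y. u y * indicator E0 y) \<in> borel_measurable borel"
    "(\<lambda>y. v y * indicator E0 y) \<in> borel_measurable borel"
    using add E0 by measurable
  show ?case
  proof (rule tonelli_add[OF add(7,6)])
    show "nn_convolution \<mu> A (\<lambda>y. (v y + u y) * indicator E0 y) z
        = nn_convolution \<mu> A (\<lambda>y. v y * indicator E0 y) z
          + nn_convolution \<mu> A (\<lambda>y. u y * indicator E0 y) z" for z
      unfolding nn_convolution_def
      using conv_integrand_measurable[OF A m(1)] conv_integrand_measurable[OF A m(2)]
      by (subst nn_integral_add[symmetric]) (auto simp: distrib_right distrib_left)
    show "(\<integral>\<^sup>+y. A y \<partial>\<mu>) * (\<integral>\<^sup>+y. v y * indicator E0 y \<partial>\<mu>)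
        + (\<integral>\<^sup>+y. A y \<partial>\<mu>) * (\<integral>\<^sup>+y. u y * indicator E0 y \<partial>\<mu>)
        \<le> (\<integral>\<^sup>+y. A y \<partial>\<mu>) * (\<integral>\<^sup>+y. (v y + u y) * indicator E0 y \<partial>\<mu>)"
      using m by (simp add: distrib_right distrib_left nn_integral_add)
  qed
next
  case (seq U)
  have eq: "(\<lambda>y. (SUP i. U i) y * indicator E0 y) = (\<lambda>y. SUP i. U i y * indicator E0 y)"
    by (simp add: SUP_mult_right_ennreal image_comp)
  have m: "(\<lambda>y. U i y * indicator E0 y) \<in> borel_measurable borel" for i
    using seq(1)[of i] E0 by measurable
  have inc: "incseq (\<lambda>i y. U i y * indicator E0 y)"
    using seq(3) by (auto simp: incseq_def le_fun_def intro!: mult_right_mono)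
  show ?case
    unfolding eq
  proof (rule tonelli_SUP[OF seq(5)])
    show "nn_convolution \<mu> A (\<lambda>y. SUP i. U i y * indicator E0 y) z
        = (SUP i. nn_convolution \<mu> A (\<lambda>y. U i y * indicator E0 y) z)" for z
      by (rule nn_convolution_SUP_right[OF A m inc])
    show "(\<lambda>y. U i y * indicator E0 y) \<le> (\<lambda>y. SUP i. U i y * indicator E0 y)" for i
      by (auto simp: le_fun_def intro: SUP_upper)
  qed (use inc in \<open>auto simp: incseq_def\<close>)
qed

lemma sigma_finite_on_exhaustion:
  fixes A :: "'a \<Rightarrow> ennreal"
  assumes "sigma_finite_on \<mu> {x. A x \<noteq> 0}"
  obtains E :: "nat \<Rightarrow> 'a set" where
    "\<And>n. E n \<in> sets borel" "\<And>n. emeasure \<mu> (E n) < \<infinity>"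
    "incseq (\<lambda>n y. A y * indicator (E n) y)" "\<And>y. (SUP n. A y * indicator (E n) y) = A y"
proof -
  obtain F :: "nat \<Rightarrow> 'a set" where F: "\<And>n. F n \<in> sets \<mu>" "\<And>n. emeasure \<mu> (F n) < \<infinity>"
    "{x. A x \<noteq> 0} \<subseteq> (\<Union>n. F n)"
    using assms unfolding sigma_finite_on_def by metis
  define E where "E n = (\<Union>i\<le>n. F i)" for n
  have Eb: "E n \<in> sets borel" for n
    using F(1) unfolding E_def by auto
  have "emeasure \<mu> (E n) \<le> (\<Sum>i\<le>n. emeasure \<mu> (F i))" for n
    unfolding E_def using F(1) by (intro emeasure_subadditive_finite) auto
  also have "(\<Sum>i\<le>n. emeasure \<mu> (F i)) < \<infinity>" for n
    using F(2) by (auto simp: less_top)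
  finally have fin: "emeasure \<mu> (E n) < \<infinity>" for n .
  have "E n \<subseteq> E m" if "n \<le> m" for n m
    unfolding E_def using that by (intro UN_mono) auto
  then have inc: "incseq (\<lambda>n y. A y * indicator (E n) y)"
    by (auto simp: incseq_def le_fun_def indicator_def intro!: mult_left_mono)
  have "(SUP n. A y * indicator (E n) y) = A y" for y
  proof (rule antisym)
    show "A y \<le> (SUP n. A y * indicator (E n) y)"
    proof (cases "A y = 0")
      case False
      then obtain n where "y \<in> F n"
        using F(3) by auto
      then have "y \<in> E n"
        by (auto simp: E_def)
      then have "A y = A y * indicator (E n) y"
        by simp
      also have "\<dots> \<le> (SUP n. A y * indicator (E n) y)"
        by (rule SUP_upper) simp
      finally show ?thesis .
    qed simp
    show "(SUP n. A y * indicator (E n) y) \<le> A y"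
      by (rule SUP_least) (auto simp: indicator_def)
  qed
  then show thesis
    using that[OF Eb fin inc] by blast
qed

text \<open>Both functions are first truncated to sets of finite measure, so that
  \<open>tonelli_indicator\<close> meets only subsets of some \<open>E n\<close> and
  \<open>F m\<close>. Sets are then replaced by functions in one factor at a time, and the
  truncations are removed last by monotone limits.\<close>

theorem tonelli_sigma_finite:
  assumes A: "A \<in> borel_measurable borel" and B: "B \<in> borel_measurable borel"
    and sA: "sigma_finite_on \<mu> {x. A x \<noteq> 0}" and sB: "sigma_finite_on \<mu> {x. B x \<noteq> 0}"
  shows "tonelli A B"
proof -
  obtain E :: "nat \<Rightarrow> 'a set" where E: "\<And>n. E n \<in> sets borel" "\<And>n. emeasure \<mu> (E n) < \<infinity>"
    "incseq (\<lambda>n y. A y * indicator (E n) y)" "\<And>y. (SUP n. A y * indicator (E n) y) = A y"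
    by (rule sigma_finite_on_exhaustion[OF sA]) (rule that)
  obtain F :: "nat \<Rightarrow> 'a set" where F: "\<And>n. F n \<in> sets borel" "\<And>n. emeasure \<mu> (F n) < \<infinity>"
    "incseq (\<lambda>n y. B y * indicator (F n) y)" "\<And>y. (SUP n. B y * indicator (F n) y) = B y"
    by (rule sigma_finite_on_exhaustion[OF sB]) (rule that)
  have mA: "(\<lambda>y. A y * indicator (E n) y) \<in> borel_measurable borel" for n
    using A E(1)[of n] by measurable
  have mB: "(\<lambda>y. B y * indicator (F n) y) \<in> borel_measurable borel" for n
    using B F(1)[of n] by measurable
  have fin: "emeasure \<mu> X < \<infinity>" if "X \<subseteq> Y" "Y \<in> sets borel" "emeasure \<mu> Y < \<infinity>" for X Y
    using that emeasure_mono[of X Y \<mu>] by (auto intro: le_less_trans)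
  have set_set: "tonelli (indicator X) (indicator Y)"
    if "X \<in> sets borel" "X \<subseteq> E n" "Y \<in> sets borel" "Y \<subseteq> F m" for X Y n m
    by (rule tonelli_indicator[OF that(1) fin[OF that(2) E(1,2)] that(3) fin[OF that(4) F(1,2)]])
  have fun_set: "tonelli (\<lambda>y. A y * indicator (E n) y) (indicator Y)"
    if "Y \<in> sets borel" "Y \<subseteq> F m" for Y n m
    by (rule tonelli_left_induct[OF A _ E(1) set_set[OF _ _ that]]) (use that in auto)
  have fun_fun: "tonelli (\<lambda>y. A y * indicator (E n) y) (\<lambda>y. B y * indicator (F m) y)" for n m
    by (rule tonelli_right_induct[OF mA B F(1) fun_set])
  have fun_B: "tonelli (\<lambda>y. A y * indicator (E n) y) B" for n
  proof (rule tonelli_SUP[OF fun_fun])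
    show "nn_convolution \<mu> (\<lambda>y. A y * indicator (E n) y) B z
        = (SUP m. nn_convolution \<mu> (\<lambda>y. A y * indicator (E n) y) (\<lambda>y. B y * indicator (F m) y) z)" for z
      using nn_convolution_SUP_right[OF mA mB F(3), of n z] by (simp only: F(4))
    show "(\<lambda>y. B y * indicator (F m) y) \<le> B" for m
      by (auto simp: le_fun_def indicator_def)
  qed (use F(3) in \<open>auto simp: incseq_def\<close>)
  show ?thesis
  proof (rule tonelli_SUP[OF fun_B])
    show "nn_convolution \<mu> A B z = (SUP n. nn_convolution \<mu> (\<lambda>y. A y * indicator (E n) y) B z)" for z
      using nn_convolution_SUP_left[OF mA B E(3), of z] by (simp only: E(4))
    show "(\<lambda>y. A y * indicator (E n) y) \<le> A" for n
      by (auto simp: le_fun_def indicator_def)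
  qed (use E(3) in \<open>auto simp: incseq_def\<close>)
qed

end

subsection \<open>Convolutions of functions that are square integrable for a weight\<close>

lemma ennsqrt_power2: "(ennsqrt c)\<^sup>2 = c"
  by (cases c) (auto simp: ennsqrt_def ennreal_power power2_eq_square ennreal_mult_top
      simp flip: ennreal_mult)

lemma ennsqrt_mono: "a \<le> b \<Longrightarrow> ennsqrt a \<le> ennsqrt b"
  by (auto simp: ennsqrt_def top_unique intro!: ennreal_leI real_sqrt_le_mono enn2real_mono)
     (auto simp: less_top)

lemma ennsqrt_mult: "ennsqrt (a * b) = ennsqrt a * ennsqrt b"
proof (cases a; cases b)
  fix r s assume "0 \<le> r" "a = ennreal r" "0 \<le> s" "b = ennreal s"
  then show ?thesis
    by (simp add: ennsqrt_def real_sqrt_mult flip: ennreal_mult)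
qed (auto simp: ennsqrt_def ennreal_mult_top ennreal_top_mult ennreal_mult_eq_top_iff enn2real_eq_0_iff)

lemma ennsqrt_less_top_iff: "ennsqrt c < \<infinity> \<longleftrightarrow> c < \<infinity>"
  by (cases c) (simp_all add: ennsqrt_def)

lemma measurable_ennsqrt [measurable]: "ennsqrt \<in> borel_measurable borel"
proof -
  have "ennsqrt = (\<lambda>c. if c \<in> {\<infinity>} then \<infinity> else ennreal (sqrt (enn2real c)))"
    by (auto simp: ennsqrt_def fun_eq_iff)
  also have "\<dots> \<in> borel_measurable borel"
    by (rule measurable_If_set) auto
  finally show ?thesis .
qed

lemma power2_le_imp_le_ennreal:
  fixes a b :: ennreal
  assumes "a\<^sup>2 \<le> b\<^sup>2"
  shows "a \<le> b"
proof -
  have "ennsqrt (x\<^sup>2) = x" for x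
    using ennsqrt_power2[of x] by (simp add: power2_eq_square ennsqrt_mult)
  then show ?thesis
    using ennsqrt_mono[OF assms] by simp
qed

text \<open>The usual inequality for the square roots of a and b. Bounding the square of c avoids
  quotients, which would be troublesome at the values 0 and \<infinity>.\<close>

lemma Cauchy_Schwarz_nn_integral_AE:
  assumes [measurable]: "c \<in> borel_measurable M" "a \<in> borel_measurable M" "b \<in> borel_measurable M"
    and le: "AE x in M. (c x)\<^sup>2 \<le> a x * b x"
  shows "(\<integral>\<^sup>+x. c x \<partial>M)\<^sup>2 \<le> (\<integral>\<^sup>+x. a x \<partial>M) * (\<integral>\<^sup>+x. b x \<partial>M)"
proof -
  have "AE x in M. c x \<le> ennsqrt (a x) * ennsqrt (b x)"
    using le
  proof eventually_elim
    case (elim x)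
    show ?case
      by (rule power2_le_imp_le_ennreal) (use elim in \<open>simp add: ennsqrt_power2 power_mult_distrib\<close>)
  qed
  then have "(\<integral>\<^sup>+x. c x \<partial>M) \<le> (\<integral>\<^sup>+x. ennsqrt (a x) * ennsqrt (b x) \<partial>M)"
    by (rule nn_integral_mono_AE)
  then have "(\<integral>\<^sup>+x. c x \<partial>M)\<^sup>2 \<le> (\<integral>\<^sup>+x. ennsqrt (a x) * ennsqrt (b x) \<partial>M)\<^sup>2"
    by (rule power_mono) simp
  also have "\<dots> \<le> (\<integral>\<^sup>+x. (ennsqrt (a x))\<^sup>2 \<partial>M) * (\<integral>\<^sup>+x. (ennsqrt (b x))\<^sup>2 \<partial>M)"
    by (rule Cauchy_Schwarz_nn_integral) measurable
  finally show ?thesis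
    by (simp add: ennsqrt_power2)
qed

text \<open>
  The decomposition \<open>z = (\<Sum>k<4. \<i>\<^sup>k z\<^sub>k)\<close> with \<open>z\<^sub>k \<ge> 0\<close> reduces convolutions of complex functions
  to \<^const>\<open>nn_convolution\<close>.
\<close>

definition quadrant_part :: "nat \<Rightarrow> complex \<Rightarrow> real" where
  "quadrant_part k z = max 0 (Re ((- \<i>) ^ k * z))"

text \<open>For k = 0, 1, 2, 3 the parts are the positive parts of Re z, Im z, -Re z and -Im
  z.\<close>

lemma sum_quadrant_parts: "(\<Sum>k<4. \<i> ^ k * of_real (quadrant_part k z)) = z"
  by (simp add: quadrant_part_def eval_nat_numeral complex_eq_iff max_def)

lemma quadrant_part_nonneg: "0 \<le> quadrant_part k z"
  by (simp add: quadrant_part_def)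

lemma quadrant_part_le: "quadrant_part k z \<le> cmod z"
  using complex_Re_le_cmod[of "(- \<i>) ^ k * z"]
  by (simp add: quadrant_part_def norm_mult norm_power)

lemma measurable_quadrant_part [measurable]: "quadrant_part k \<in> borel_measurable borel"
  unfolding quadrant_part_def by measurable

context locally_compact_haar
begin

text \<open>Each of the 16 convolutions of nonnegative parts has a Borel version by Tonelli's
  inequality, and \<open>H\<close> recombines their finite values. The recombination gives the
  complex integral only where it converges, since elsewhere some of the parts may be infinite; this
  is the reason for the guard.\<close>

lemma convolution_borel_version:
  fixes f g :: "'a \<Rightarrow> complex"
  assumes f[measurable]: "f \<in> borel_measurable borel" and g[measurable]: "g \<in> borel_measurable borel"
    and sf: "sigma_finite_on \<mu> {x. f x \<noteq> 0}" and sg: "sigma_finite_on \<mu> {x. g x \<noteq> 0}"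
  shows "\<exists>h\<in>borel_measurable borel. AE z in \<mu>.
    integrable \<mu> (\<lambda>y. f y * g (- y + z)) \<longrightarrow> (LINT y|\<mu>. f y * g (- y + z)) = h z"
proof -
  define fp where "fp j y = ennreal (quadrant_part j (f y))" for j y
  define gp where "gp j y = ennreal (quadrant_part j (g y))" for j y
  have fp[measurable]: "fp j \<in> borel_measurable borel" and gp[measurable]: "gp j \<in> borel_measurable borel" for j
    unfolding fp_def gp_def by measurable
  have "{x. fp j x \<noteq> 0} \<subseteq> {x. f x \<noteq> 0}" "{x. gp j x \<noteq> 0} \<subseteq> {x. g x \<noteq> 0}" for j
    by (auto simp: fp_def gp_def quadrant_part_def)
  then have "tonelli (fp j) (gp k)" for j k
    using tonelli_sigma_finite[OF fp gp] sigma_finite_on_subset[OF sf] sigma_finite_on_subset[OF sg]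
    by blast
  then have "\<exists>h\<in>borel_measurable borel. AE z in \<mu>. nn_convolution \<mu> (fp j) (gp k) z = h z" for j k
    unfolding tonelli_def by blast
  then obtain h where h[measurable]: "\<And>j k. h j k \<in> borel_measurable borel"
    and h_eq: "\<And>j k. AE z in \<mu>. nn_convolution \<mu> (fp j) (gp k) z = h j k z"
    by metis
  define H where "H z = (\<Sum>j<4. \<Sum>k<4. \<i> ^ j * \<i> ^ k * of_real (enn2real (h j k z)))" for z
  have "AE z in \<mu>. \<forall>j k. nn_convolution \<mu> (fp j) (gp k) z = h j k z"
    using h_eq by (simp add: AE_all_countable)
  then have "AE z in \<mu>. integrable \<mu> (\<lambda>y. f y * g (- y + z)) \<longrightarrow>
      (LINT y|\<mu>. f y * g (- y + z)) = H z"
  proof eventually_elim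
    case (elim z)
    show ?case
    proof
      assume int: "integrable \<mu> (\<lambda>y. f y * g (- y + z))"
      have gz[measurable]: "(\<lambda>y. g (- y + z)) \<in> borel_measurable borel"
        by (rule measurable_compose[OF measurable_reflection g])
      define r where "r j k y = quadrant_part j (f y) * quadrant_part k (g (- y + z))" for j k y
      have r[measurable]: "r j k \<in> borel_measurable borel" for j k
        unfolding r_def by measurable
      have r0: "0 \<le> r j k y" for j k y
        by (simp add: r_def quadrant_part_nonneg)
      \<comment> \<open>Each product of parts is at most |f(y) g(-y + z)|, so integrability of the
        complex integrand passes to all of them.\<close>
      have int_r: "integrable \<mu> (r j k)" for j k
      proof (rule Bochner_Integration.integrable_bound[OF int])
        show "AE y in \<mu>. norm (r j k y) \<le> norm (f y * g (- y + z))"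
          by (auto simp: r_def norm_mult quadrant_part_nonneg intro!: mult_mono quadrant_part_le)
      qed simp
      have r_eq: "(LINT y|\<mu>. r j k y) = enn2real (h j k z)" for j k
      proof -
        have "(\<integral>\<^sup>+y. ennreal (r j k y) \<partial>\<mu>) = h j k z"
          using elim unfolding nn_convolution_def fp_def gp_def r_def
          by (simp add: ennreal_mult quadrant_part_nonneg)
        then show ?thesis
          by (subst integral_eq_nn_integral) (auto simp: r0)
      qed
      have "f y * g (- y + z) = (\<Sum>j<4. \<Sum>k<4. \<i> ^ j * \<i> ^ k * of_real (r j k y))" for y
        by (subst (1) sum_quadrant_parts[of "f y", symmetric],
            subst (1) sum_quadrant_parts[of "g (- y + z)", symmetric])
           (simp only: sum_product r_def of_real_mult mult_ac)
      then have "(LINT y|\<mu>. f y * g (- y + z))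
          = (LINT y|\<mu>. (\<Sum>j<4. \<Sum>k<4. \<i> ^ j * \<i> ^ k * of_real (r j k y)))"
        by (simp only:)
      also have "\<dots> = H z"
        using int_r by (simp add: H_def r_eq Bochner_Integration.integral_sum)
      finally show "(LINT y|\<mu>. f y * g (- y + z)) = H z" .
    qed
  qed
  moreover have "H \<in> borel_measurable borel"
    unfolding H_def by measurable
  ultimately show ?thesis by blast
qed

end

section \<open>Reduction of the convolution on S to functions on the whole group\<close>

lemma mem_conv_domain: "y \<in> conv_domain S z \<longleftrightarrow> y \<in> S \<and> - y + z \<in> S"
proof -
  have "y \<in> (\<lambda>s. z - s) ` S \<longleftrightarrow> - y + z \<in> S"
  proof
    assume "y \<in> (\<lambda>s. z - s) ` S"
    then show "- y + z \<in> S"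
      by (auto simp: minus_diff_eq)
  next
    assume "- y + z \<in> S"
    moreover have "y = z - (- y + z)"
      by (simp add: diff_conv_add_uminus minus_add add.assoc[symmetric])
    ultimately show "y \<in> (\<lambda>s. z - s) ` S"
      by blast
  qed
  then show ?thesis
    by (simp add: conv_domain_def)
qed

text \<open>Vanishing off S turns integrals over \<open>conv_domain S z\<close> into integrals over
  the group. The weight is always that of the space which is to contain the convolution, even for
  the factor taken from the other space.\<close>

definition cut_off :: "'a set \<Rightarrow> ('a \<Rightarrow> ennreal) \<Rightarrow> ('a \<Rightarrow> complex) \<Rightarrow> 'a \<Rightarrow> complex" where
  "cut_off S w f x = (if x \<in> S \<and> w x \<noteq> 0 then f x else 0)"

context locally_compact_haar
begin

text \<open>
  Submultiplicativity makes the convolution at points of positive weight depend only on the values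
  at points of positive weight; off that set an element of \<open>L\<^sub>2\<close> is arbitrary and its support
  need not be \<open>\<sigma>\<close>-finite.
\<close>

lemma convolution_integrand_cut_off:
  assumes "\<And>x y. x \<in> S \<Longrightarrow> y \<in> S \<Longrightarrow> w (x + y) \<le> w x * w y" "w z \<noteq> 0"
  shows "indicator (conv_domain S z) y *\<^sub>R (f y * g (- y + z)) = cut_off S w f y * cut_off S w g (- y + z)"
proof (cases "y \<in> conv_domain S z")
  case True
  then have S: "y \<in> S" "- y + z \<in> S"
    by (simp_all add: mem_conv_domain)
  have "y + (- y + z) = z"
    by (simp add: add.assoc[symmetric])
  then have "w z \<le> w y * w (- y + z)"
    using assms(1)[OF S] by simp
  then have "w y \<noteq> 0" "w (- y + z) \<noteq> 0"
    using assms(2) by auto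
  then show ?thesis
    using True S by (simp add: cut_off_def)
next
  case False
  then show ?thesis
    by (auto simp: cut_off_def mem_conv_domain)
qed

text \<open>Passage from the pointwise estimate \<open>key\<close> to the norm: integrate the Borel
  version of the convolution of A and B. \<open>A\<close>, \<open>B\<close> and \<open>I\<close>
  remain abstract because the two orders of the factors fill them differently.\<close>

lemma convolution_L2_bound:
  fixes f g :: "'a \<Rightarrow> complex" and w A B :: "'a \<Rightarrow> ennreal"
  assumes S[measurable]: "S \<in> sets borel" and w[measurable]: "w \<in> borel_measurable borel"
    and sub: "\<And>x y. x \<in> S \<Longrightarrow> y \<in> S \<Longrightarrow> w (x + y) \<le> w x * w y"
    and f[measurable]: "cut_off S w f \<in> borel_measurable borel"
    and g[measurable]: "cut_off S w g \<in> borel_measurable borel"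
    and sf: "sigma_finite_on \<mu> {x. cut_off S w f x \<noteq> 0}"
    and sg: "sigma_finite_on \<mu> {x. cut_off S w g x \<noteq> 0}"
    and AB: "tonelli A B" and fin: "(\<integral>\<^sup>+y. A y \<partial>\<mu>) < \<infinity>" "(\<integral>\<^sup>+y. B y \<partial>\<mu>) < \<infinity>"
    and key: "AE z in \<mu>. z \<in> S \<longrightarrow> w z \<noteq> 0 \<longrightarrow>
      w z * (\<integral>\<^sup>+y. ennreal (cmod (cut_off S w f y * cut_off S w g (- y + z))) \<partial>\<mu>)\<^sup>2
        \<le> I * nn_convolution \<mu> A B z"
  shows "L2_norm S (density \<mu> w) (convolution S \<mu> f g)
      \<le> ennsqrt (I * ((\<integral>\<^sup>+y. A y \<partial>\<mu>) * (\<integral>\<^sup>+y. B y \<partial>\<mu>)))"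
    and "I < \<infinity> \<Longrightarrow> convolution_in_L2 S \<mu> (density \<mu> w) f g"
proof -
  define a where "a = cut_off S w f"
  define b where "b = cut_off S w g"
  have [measurable]: "a \<in> borel_measurable borel" "b \<in> borel_measurable borel"
    by (simp_all add: a_def b_def f g)
  define N where "N z = (\<integral>\<^sup>+y. ennreal (cmod (a y * b (- y + z))) \<partial>\<mu>)" for z
  define na nb where "na y = ennreal (cmod (a y))" and "nb y = ennreal (cmod (b y))" for y
  have na[measurable]: "na \<in> borel_measurable borel" and nb[measurable]: "nb \<in> borel_measurable borel"
    unfolding na_def nb_def by measurable
  have meas_ab: "(\<lambda>y. a y * b (- y + z)) \<in> borel_measurable borel" for z
    by (rule complex_conv_integrand_measurable) measurable
  have N_conv: "N z = nn_convolution \<mu> na nb z" for z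
    unfolding N_def nn_convolution_def na_def nb_def by (simp add: norm_mult ennreal_mult)
  have integrable_iff: "integrable \<mu> (\<lambda>y. a y * b (- y + z)) \<longleftrightarrow> N z < \<infinity>" for z
    unfolding integrable_iff_bounded N_def using meas_ab[of z] by auto
  have exists_iff: "convolution_exists S \<mu> f g z \<longleftrightarrow> N z < \<infinity>"
    and conv_eq: "convolution S \<mu> f g z = (LINT y|\<mu>. a y * b (- y + z))" if "w z \<noteq> 0" for z
    using convolution_integrand_cut_off[OF sub that, where f = f and g = g] integrable_iff[of z]
    by (simp_all add: convolution_exists_def set_integrable_def convolution_def
        set_lebesgue_integral_def a_def b_def)
  have conv_le: "ennreal (cmod (convolution S \<mu> f g z)) \<le> N z" if "w z \<noteq> 0" for z
  proof (cases "N z < \<infinity>")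
    case True
    then show ?thesis
      using integral_norm_bound_ennreal[of \<mu> "\<lambda>y. a y * b (- y + z)"] integrable_iff[of z]
      by (simp add: conv_eq[OF that] N_def)
  next
    case False
    then show ?thesis by (simp add: less_top[symmetric])
  qed
  have "tonelli na nb"
  proof (rule tonelli_sigma_finite[OF na nb])
    show "sigma_finite_on \<mu> {x. na x \<noteq> 0}" "sigma_finite_on \<mu> {x. nb x \<noteq> 0}"
      using sf sg by (simp_all add: na_def nb_def a_def b_def)
  qed
  then obtain n where n[measurable]: "n \<in> borel_measurable borel" and n_eq: "AE z in \<mu>. N z = n z"
    unfolding tonelli_def N_conv by auto
  obtain h where h[measurable]: "h \<in> borel_measurable borel"
    and h_eq: "AE z in \<mu>. N z < \<infinity> \<longrightarrow> (LINT y|\<mu>. a y * b (- y + z)) = h z"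
    using convolution_borel_version[OF f g sf sg] unfolding a_def[symmetric] b_def[symmetric] integrable_iff
    by auto
  obtain k where k[measurable]: "k \<in> borel_measurable borel"
    and k_eq: "AE z in \<mu>. nn_convolution \<mu> A B z = k z"
    and k_le: "(\<integral>\<^sup>+z. k z \<partial>\<mu>) \<le> (\<integral>\<^sup>+y. A y \<partial>\<mu>) * (\<integral>\<^sup>+y. B y \<partial>\<mu>)"
    using AB unfolding tonelli_def by auto
  \<comment> \<open>The value 0 where the absolute integral diverges is the default value of the
    Bochner integral, so that \<open>H\<close> agrees with the convolution almost everywhere on {w
    \<noteq> 0} and not merely where it converges.\<close>
  define H where "H z = (if n z < \<infinity> then h z else 0)" for z
  have H[measurable]: "H \<in> borel_measurable borel"
    unfolding H_def by measurable
  have "AE z in \<mu>. w z \<noteq> 0 \<longrightarrow> convolution S \<mu> f g z = H z"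
    using n_eq h_eq
  proof eventually_elim
    case (elim z)
    show ?case
    proof
      assume w: "w z \<noteq> 0"
      show "convolution S \<mu> f g z = H z"
      proof (cases "N z < \<infinity>")
        case True
        then show ?thesis
          using elim conv_eq[OF w] by (simp add: H_def)
      next
        case False
        then have "convolution S \<mu> f g z = 0"
          using conv_eq[OF w] integrable_iff[of z] by (simp add: not_integrable_integral_eq)
        then show ?thesis
          using False elim by (simp add: H_def)
      qed
    qed
  qed
  note H_eq = this
  have ae_density: "(AE z in density \<mu> w. z \<in> S \<longrightarrow> P z) \<longleftrightarrow> (AE z in \<mu>. w z \<noteq> 0 \<longrightarrow> z \<in> S \<longrightarrow> P z)" for P
    by (subst AE_density) (auto simp: less_top zero_less_iff_neq_zero)
  have H_eq': "AE z in density \<mu> w. z \<in> S \<longrightarrow> convolution S \<mu> f g z = H z"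
    unfolding ae_density using H_eq by eventually_elim auto
  have bound: "AE z in \<mu>. w z * (ennreal ((cmod (H z))\<^sup>2) * indicator S z) \<le> I * k z"
    using key H_eq k_eq
  proof eventually_elim
    case (elim z)
    show ?case
    proof (cases "z \<in> S \<and> w z \<noteq> 0")
      case True
      have "w z * (ennreal ((cmod (H z))\<^sup>2) * indicator S z) = w z * (ennreal (cmod (convolution S \<mu> f g z)))\<^sup>2"
        using True elim by (simp add: ennreal_power)
      also have "\<dots> \<le> w z * (N z)\<^sup>2"
        using conv_le[of z] True by (intro mult_left_mono power_mono) auto
      also have "\<dots> \<le> I * k z"
        using elim True by (simp add: N_def a_def b_def)
      finally show ?thesis .
    qed (auto simp: indicator_def)
  qed
  have "(\<integral>\<^sup>+z\<in>S. ennreal ((cmod (convolution S \<mu> f g z))\<^sup>2) \<partial>density \<mu> w)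
      = (\<integral>\<^sup>+z\<in>S. ennreal ((cmod (H z))\<^sup>2) \<partial>density \<mu> w)"
    using H_eq' by (intro nn_integral_cong_AE) (auto elim!: eventually_mono simp: indicator_def)
  then have norm_eq: "L2_norm S (density \<mu> w) (convolution S \<mu> f g) = L2_norm S (density \<mu> w) H"
    by (simp add: L2_norm_def)
  have "(\<integral>\<^sup>+z\<in>S. ennreal ((cmod (H z))\<^sup>2) \<partial>density \<mu> w)
      = (\<integral>\<^sup>+z. w z * (ennreal ((cmod (H z))\<^sup>2) * indicator S z) \<partial>\<mu>)"
    by (subst nn_integral_density) auto
  also have "\<dots> \<le> (\<integral>\<^sup>+z. I * k z \<partial>\<mu>)"
    using bound by (rule nn_integral_mono_AE)
  also have "\<dots> = I * (\<integral>\<^sup>+z. k z \<partial>\<mu>)"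
    by (intro nn_integral_cmult) auto
  also have "\<dots> \<le> I * ((\<integral>\<^sup>+y. A y \<partial>\<mu>) * (\<integral>\<^sup>+y. B y \<partial>\<mu>))"
    using k_le by (rule mult_left_mono) simp
  finally have "L2_norm S (density \<mu> w) H \<le> ennsqrt (I * ((\<integral>\<^sup>+y. A y \<partial>\<mu>) * (\<integral>\<^sup>+y. B y \<partial>\<mu>)))"
    unfolding L2_norm_def by (rule ennsqrt_mono)
  then show le: "L2_norm S (density \<mu> w) (convolution S \<mu> f g)
      \<le> ennsqrt (I * ((\<integral>\<^sup>+y. A y \<partial>\<mu>) * (\<integral>\<^sup>+y. B y \<partial>\<mu>)))"
    by (simp add: norm_eq)
  assume I: "I < \<infinity>"
  have "I * ((\<integral>\<^sup>+y. A y \<partial>\<mu>) * (\<integral>\<^sup>+y. B y \<partial>\<mu>)) < \<infinity>"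
    using I fin by (simp add: ennreal_mult_less_top)
  then have "L2_norm S (density \<mu> w) H < \<infinity>"
    by (rule le_less_trans[OF le[unfolded norm_eq] iffD2[OF ennsqrt_less_top_iff]])
  moreover have "H \<in> borel_measurable (restrict_space (density \<mu> w) S)"
    by (rule measurable_restrict_space1) simp
  ultimately have H_L2: "H \<in> L2 S (density \<mu> w)"
    by (simp add: L2_def)
  \<comment> \<open>Convergence almost everywhere comes from the norm estimate itself:
    \<open>k\<close> is finite almost everywhere, so for finite \<open>I\<close> the product of w(z)
    and the squared absolute integral is finite, and w(z) is not 0.\<close>
  have "(\<integral>\<^sup>+z. k z \<partial>\<mu>) \<noteq> \<infinity>"
    using k_le fin by (auto simp: ennreal_mult_eq_top_iff top_unique)
  then have "AE z in \<mu>. k z \<noteq> \<infinity>"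
    by (intro nn_integral_PInf_AE) auto
  then have "AE z in \<mu>. w z \<noteq> 0 \<longrightarrow> z \<in> S \<longrightarrow> convolution_exists S \<mu> f g z"
    using key k_eq
  proof eventually_elim
    case (elim z)
    show ?case
    proof (intro impI)
      assume z: "w z \<noteq> 0" "z \<in> S"
      have "w z * (N z)\<^sup>2 \<le> I * k z"
        using elim z by (simp add: N_def a_def b_def)
      also have "\<dots> < \<infinity>"
        using I elim by (simp add: ennreal_mult_less_top less_top)
      finally have "N z < \<infinity>"
        using z by (auto simp: ennreal_mult_less_top power_less_top_ennreal)
      then show "convolution_exists S \<mu> f g z"
        using exists_iff z by simp
    qed
  qed
  then show "convolution_in_L2 S \<mu> (density \<mu> w) f g"
    unfolding convolution_in_L2_def ae_density using H_L2 H_eq' unfolding ae_density by blast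
qed

end

text \<open>\<open>X\<close> and \<open>Y\<close> are weights at the points y and -y + z, and
  \<open>W\<close> is the weight at z, constant in y. Its square root is attached to the integrand
  so that Cauchy-Schwarz can absorb it.\<close>

lemma weighted_product_bound:
  fixes W X Y :: ennreal
  assumes "W \<le> X * Y"
  shows "(ennsqrt W * ennreal (cmod (p * q)))\<^sup>2
    \<le> (ennreal ((cmod p)\<^sup>2) * X) * (ennreal ((cmod q)\<^sup>2) * Y)"
proof -
  have "(ennsqrt W * ennreal (cmod (p * q)))\<^sup>2 = W * (ennreal ((cmod p)\<^sup>2) * ennreal ((cmod q)\<^sup>2))"
    by (simp add: power_mult_distrib ennsqrt_power2 ennreal_power norm_mult ennreal_mult)
  also have "\<dots> \<le> (X * Y) * (ennreal ((cmod p)\<^sup>2) * ennreal ((cmod q)\<^sup>2))"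
    using assms by (rule mult_right_mono) simp
  finally show ?thesis
    by (simp add: mult_ac)
qed

section \<open>Relations between the densities, and the weighted estimate\<close>

context locally_compact_haar
begin

text \<open>Equal measures need not have almost everywhere equal densities when \<open>\<mu>\<close>
  is not \<sigma>-finite. After restriction of \<open>\<mu>\<close> to one set \<open>E n\<close> of
  finite measure uniqueness is available, and countably many such sets cover X.\<close>

lemma density_chain_AE:
  assumes v[measurable]: "v \<in> borel_measurable borel" and w[measurable]: "w \<in> borel_measurable borel"
    and D[measurable]: "D \<in> borel_measurable borel"
    and chain: "density (density \<mu> v) D = density \<mu> w" and X: "sigma_finite_on \<mu> X"
  shows "AE y in \<mu>. y \<in> X \<longrightarrow> w y = v y * D y"
proof -
  obtain E :: "nat \<Rightarrow> 'a set" where E: "\<And>n. E n \<in> sets \<mu>" "\<And>n. emeasure \<mu> (E n) < \<infinity>"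
    "X \<subseteq> (\<Union>n. E n)"
    using X unfolding sigma_finite_on_def by metis
  have "AE y in \<mu>. y \<in> E n \<longrightarrow> w y = v y * D y" for n
  proof -
    have [measurable]: "E n \<in> sets borel"
      using E(1)[of n] by simp
    interpret finite_measure "density \<mu> (indicator (E n))"
      by standard (use E in \<open>simp add: emeasure_density less_top\<close>)
    have eq: "density \<mu> w = density \<mu> (\<lambda>y. v y * D y)"
      using chain by (subst (asm) density_density_eq) auto
    have "density (density \<mu> (indicator (E n))) w = density (density \<mu> w) (indicator (E n))"
      by (simp add: density_density_eq mult.commute)
    also have "\<dots> = density (density \<mu> (indicator (E n))) (\<lambda>y. v y * D y)"
      unfolding eq by (simp add: density_density_eq mult.commute)
    finally have "AE y in density \<mu> (indicator (E n)). w y = v y * D y"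
      by (intro density_unique) auto
    then show ?thesis
      by (subst (asm) AE_density) (auto elim!: eventually_mono)
  qed
  then have "AE y in \<mu>. \<forall>n. y \<in> E n \<longrightarrow> w y = v y * D y"
    unfolding AE_all_countable by (rule allI)
  then show ?thesis
  proof eventually_elim
    case (elim y)
    then show ?case
      using E(3) by blast
  qed
qed

text \<open>The set {v = 0} is null for \<open>density \<mu> v\<close>, hence for any density over
  it. Integrability of |f|^2 v controls the support of f only where v is nonzero; this lemma
  accounts for the remainder after cutting by w.\<close>

lemma density_chain_null:
  assumes v[measurable]: "v \<in> borel_measurable borel" and w[measurable]: "w \<in> borel_measurable borel"
    and D[measurable]: "D \<in> borel_measurable borel"
    and chain: "density (density \<mu> v) D = density \<mu> w"
  shows "{y. v y = 0 \<and> w y \<noteq> 0} \<in> null_sets \<mu>"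
proof -
  have eq: "density \<mu> w = density \<mu> (\<lambda>y. v y * D y)"
    using chain by (subst (asm) density_density_eq) auto
  have Z[measurable]: "{y. v y = 0} \<in> sets borel"
    by measurable
  have "emeasure (density \<mu> w) {y. v y = 0} = (\<integral>\<^sup>+y. v y * D y * indicator {y. v y = 0} y \<partial>\<mu>)"
    unfolding eq by (rule emeasure_density) auto
  also have "\<dots> = (\<integral>\<^sup>+y. 0 \<partial>\<mu>)"
    by (intro nn_integral_cong) (auto simp: indicator_def)
  finally have "emeasure (density \<mu> w) {y. v y = 0} = 0"
    by simp
  then have "(\<integral>\<^sup>+y. w y * indicator {y. v y = 0} y \<partial>\<mu>) = 0"
    by (subst (asm) emeasure_density) auto
  then have "AE y in \<mu>. w y * indicator {y. v y = 0} y = 0"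
    by (subst (asm) nn_integral_0_iff_AE) auto
  then have "AE y in \<mu>. \<not> (v y = 0 \<and> w y \<noteq> 0)"
    by eventually_elim (auto simp: indicator_def split: if_splits)
  moreover have "{y. v y = 0 \<and> w y \<noteq> 0} \<in> sets \<mu>"
    by (simp, measurable)
  ultimately show ?thesis
    by (subst AE_iff_null_sets) auto
qed

text \<open>\<open>u\<close> is the weight of the norm and \<open>w\<close> the weight of the cut.
  They differ for f and coincide for g.\<close>

lemma L2_cut_off:
  assumes S[measurable]: "S \<in> sets borel" and u[measurable]: "u \<in> borel_measurable borel"
    and w[measurable]: "w \<in> borel_measurable borel" and f: "f \<in> L2 S (density \<mu> u)"
  shows "cut_off S w f \<in> borel_measurable borel"
    and "(\<integral>\<^sup>+x. ennreal ((cmod (cut_off S w f x))\<^sup>2) * u x \<partial>\<mu>) < \<infinity>"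
    and "ennsqrt (\<integral>\<^sup>+x. ennreal ((cmod (cut_off S w f x))\<^sup>2) * u x \<partial>\<mu>) \<le> L2_norm S (density \<mu> u) f"
proof -
  define f' where "f' x = indicator S x *\<^sub>R f x" for x
  have "f \<in> borel_measurable (restrict_space (density \<mu> u) S)"
    using f by (simp add: L2_def)
  then have f'[measurable]: "f' \<in> borel_measurable borel"
    unfolding f'_def by (subst (asm) borel_measurable_restrict_space_iff) auto
  have cut: "cut_off S w f = (\<lambda>x. if w x \<noteq> 0 then f' x else 0)"
    by (auto simp: cut_off_def f'_def indicator_def)
  show "cut_off S w f \<in> borel_measurable borel"
    unfolding cut by measurable
  have "(\<integral>\<^sup>+x. ennreal ((cmod (cut_off S w f x))\<^sup>2) * u x \<partial>\<mu>) \<le> (\<integral>\<^sup>+x. u x * ennreal ((cmod (f' x))\<^sup>2) \<partial>\<mu>)"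
    by (intro nn_integral_mono) (auto simp: cut mult.commute)
  also have "\<dots> = (\<integral>\<^sup>+x. ennreal ((cmod (f' x))\<^sup>2) \<partial>density \<mu> u)"
    by (subst nn_integral_density) auto
  also have "\<dots> = (\<integral>\<^sup>+x\<in>S. ennreal ((cmod (f x))\<^sup>2) \<partial>density \<mu> u)"
    by (intro nn_integral_cong) (auto simp: f'_def indicator_def)
  finally show le: "ennsqrt (\<integral>\<^sup>+x. ennreal ((cmod (cut_off S w f x))\<^sup>2) * u x \<partial>\<mu>) \<le> L2_norm S (density \<mu> u) f"
    unfolding L2_norm_def by (rule ennsqrt_mono)
  also have "\<dots> < \<infinity>"
    using f by (simp add: L2_def)
  finally show "(\<integral>\<^sup>+x. ennreal ((cmod (cut_off S w f x))\<^sup>2) * u x \<partial>\<mu>) < \<infinity>"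
    unfolding ennsqrt_less_top_iff .
qed

text \<open>Since -y + z = -(-z + y), the map is a left translation followed by inversion: the first
  preserves \<open>\<mu>\<close>, the second carries it to the right Haar measure, and z
  disappears.\<close>

lemma nn_integral_right_haar:
  assumes D[measurable]: "D \<in> borel_measurable borel"
  shows "(\<integral>\<^sup>+y. D (- y + z) \<partial>\<mu>) = (\<integral>\<^sup>+x. D x \<partial>right_haar_of \<mu>)"
proof -
  have [measurable]: "(\<lambda>x. - x :: 'a) \<in> borel_measurable borel"
    by (intro borel_measurable_continuous_onI continuous_intros)
  have "(\<integral>\<^sup>+x. D x \<partial>right_haar_of \<mu>) = (\<integral>\<^sup>+y. D (- y) \<partial>\<mu>)"
    unfolding right_haar_of_def by (rule nn_integral_distr) auto
  also have "\<dots> = (\<integral>\<^sup>+y. D (- (- z + y)) \<partial>\<mu>)"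
    by (rule nn_integral_left_translation[symmetric]) measurable
  finally show ?thesis
    by (simp add: minus_add)
qed

text \<open>Tonelli's inequality for the indicators of X and N bounds the integral by \<mu>(X) * 0,
  which is 0 in \<open>ennreal\<close> even if \<mu>(X) is infinite. It moves an exceptional null
  set to the points -y + z.\<close>

lemma AE_reflected_null:
  assumes "N \<in> null_sets \<mu>" "X \<in> sets borel" "sigma_finite_on \<mu> X"
  shows "AE z in \<mu>. AE y in \<mu>. y \<in> X \<longrightarrow> - y + z \<notin> N"
proof -
  have N: "N \<in> sets borel" "emeasure \<mu> N = 0"
    using assms(1) by auto
  have "tonelli (indicator X) (indicator N)"
    using assms N sigma_finite_on_null[OF assms(1)]
    by (intro tonelli_sigma_finite) (auto simp: indicator_def if_distrib cong: if_cong)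
  then obtain h where h: "h \<in> borel_measurable borel"
    "AE z in \<mu>. nn_convolution \<mu> (indicator X) (indicator N) z = h z" "(\<integral>\<^sup>+z. h z \<partial>\<mu>) \<le> 0"
    using N unfolding tonelli_def by auto
  have "AE z in \<mu>. h z = 0"
    using h(1,3) by (subst nn_integral_0_iff_AE[symmetric]) auto
  with h(2) show ?thesis
  proof eventually_elim
    case (elim z)
    have m: "(\<lambda>y. indicator X y * indicator N (- y + z) :: ennreal) \<in> borel_measurable \<mu>"
      using conv_integrand_measurable[of "indicator X" "indicator N" z] assms(2) N by simp
    have "(\<integral>\<^sup>+y. indicator X y * indicator N (- y + z) \<partial>\<mu>) = 0"
      using elim by (simp add: nn_convolution_def)
    then have "AE y in \<mu>. indicator X y * indicator N (- y + z) = (0::ennreal)"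
      using nn_integral_0_iff_AE[OF m] by simp
    then show ?case
      by eventually_elim (auto simp: indicator_def split: if_splits)
  qed
qed

lemma Cauchy_Schwarz_weight:
  assumes [measurable]: "c \<in> borel_measurable borel" "a \<in> borel_measurable borel" "b \<in> borel_measurable borel"
    and le: "AE y in \<mu>. (ennsqrt r * c y)\<^sup>2 \<le> a y * b y"
  shows "r * (\<integral>\<^sup>+y. c y \<partial>\<mu>)\<^sup>2 \<le> (\<integral>\<^sup>+y. a y \<partial>\<mu>) * (\<integral>\<^sup>+y. b y \<partial>\<mu>)"
proof -
  have "r * (\<integral>\<^sup>+y. c y \<partial>\<mu>)\<^sup>2 = (\<integral>\<^sup>+y. ennsqrt r * c y \<partial>\<mu>)\<^sup>2"
    by (subst nn_integral_cmult) (auto simp: power_mult_distrib ennsqrt_power2)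
  also have "\<dots> \<le> (\<integral>\<^sup>+y. a y \<partial>\<mu>) * (\<integral>\<^sup>+y. b y \<partial>\<mu>)"
    using le by (intro Cauchy_Schwarz_nn_integral_AE) auto
  finally show ?thesis .
qed

text \<open>Here v, w and D stand for the derivatives \<open>d\<mu>\<^sub>q/d\<mu>\<close>,
  \<open>d\<mu>\<^sub>p/d\<mu>\<close> and \<open>d\<mu>\<^sub>p/d\<mu>\<^sub>q\<close>, for one
  fixed pair of indices.\<close>

theorem weighted_convolution_bounds:
  fixes f g :: "'a \<Rightarrow> complex" and v w D :: "'a \<Rightarrow> ennreal"
  assumes S[measurable]: "S \<in> sets borel"
    and v[measurable]: "v \<in> borel_measurable borel" and w[measurable]: "w \<in> borel_measurable borel"
    and D[measurable]: "D \<in> borel_measurable borel"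
    and chain: "density (density \<mu> v) D = density \<mu> w"
    and sub: "\<And>x y. x \<in> S \<Longrightarrow> y \<in> S \<Longrightarrow> w (x + y) \<le> w x * w y"
    and f: "f \<in> L2 S (density \<mu> v)" and g: "g \<in> L2 S (density \<mu> w)"
  shows "L2_norm S (density \<mu> w) (convolution S \<mu> f g)
      \<le> ennsqrt (\<integral>\<^sup>+x\<in>S. D x \<partial>\<mu>) * L2_norm S (density \<mu> v) f * L2_norm S (density \<mu> w) g"
    and "(\<integral>\<^sup>+x\<in>S. D x \<partial>\<mu>) < \<infinity> \<Longrightarrow> convolution_in_L2 S \<mu> (density \<mu> w) f g"
    and "L2_norm S (density \<mu> w) (convolution S \<mu> g f)
      \<le> ennsqrt (\<integral>\<^sup>+x\<in>S. D x \<partial>right_haar_of \<mu>) * L2_norm S (density \<mu> v) f * L2_norm S (density \<mu> w) g"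
    and "(\<integral>\<^sup>+x\<in>S. D x \<partial>right_haar_of \<mu>) < \<infinity> \<Longrightarrow> convolution_in_L2 S \<mu> (density \<mu> w) g f"
proof -
  define a where "a = cut_off S w f"
  define b where "b = cut_off S w g"
  define A where "A x = ennreal ((cmod (a x))\<^sup>2) * v x" for x
  define B where "B x = ennreal ((cmod (b x))\<^sup>2) * w x" for x
  note fa = L2_cut_off[OF S v w f, folded a_def, folded A_def]
  note gb = L2_cut_off[OF S w w g, folded b_def, folded B_def]
  have a[measurable]: "a \<in> borel_measurable borel" and b[measurable]: "b \<in> borel_measurable borel"
    using fa(1) gb(1) .
  have A[measurable]: "A \<in> borel_measurable borel" and B[measurable]: "B \<in> borel_measurable borel"
    unfolding A_def B_def by measurable
  have sA: "sigma_finite_on \<mu> {x. A x \<noteq> 0}" and sB: "sigma_finite_on \<mu> {x. B x \<noteq> 0}"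
    using sigma_finite_on_support[of A \<mu>] sigma_finite_on_support[of B \<mu>] fa(2) gb(2) by simp_all
  \<comment> \<open>Where \<open>a\<close> is nonzero so is w; hence either v is nonzero and the
    point lies in the support of \<open>A\<close>, or it lies in the null set of
    \<open>density_chain_null\<close>.\<close>
  have sa: "sigma_finite_on \<mu> {x. a x \<noteq> 0}"
    by (rule sigma_finite_on_subset[OF sigma_finite_on_Un[OF sA
          sigma_finite_on_null[OF density_chain_null[OF v w D chain]]]])
       (auto simp: A_def a_def cut_off_def)
  have sb: "sigma_finite_on \<mu> {x. b x \<noteq> 0}"
    by (rule sigma_finite_on_subset[OF sB]) (auto simp: B_def b_def cut_off_def)
  have wD: "AE y in \<mu>. a y \<noteq> 0 \<longrightarrow> w y = v y * D y"
    using density_chain_AE[OF v w D chain sa] by simp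
  have a0: "x \<in> S" if "a x \<noteq> 0" for x
    using that by (auto simp: a_def cut_off_def split: if_splits)
  have b0: "x \<in> S" if "b x \<noteq> 0" for x
    using that by (auto simp: b_def cut_off_def split: if_splits)
  have sub': "w z \<le> w y * w (- y + z)" if "y \<in> S" "- y + z \<in> S" for y z
    using sub[OF that] by (simp add: add.assoc[symmetric])
  have mc: "(\<lambda>y. ennreal (cmod (p y * q (- y + z)))) \<in> borel_measurable borel"
    if "p \<in> borel_measurable borel" "q \<in> borel_measurable borel" for p q :: "'a \<Rightarrow> complex" and z
    using complex_conv_integrand_measurable[OF that] by measurable
  have DS[measurable]: "(\<lambda>y. D y * indicator S y) \<in> borel_measurable borel"
    by measurable
  have right_int: "(\<integral>\<^sup>+y. D (- y + z) * indicator S (- y + z) \<partial>\<mu>) = (\<integral>\<^sup>+x\<in>S. D x \<partial>right_haar_of \<mu>)" for z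
    using nn_integral_right_haar[OF DS] .
  have key_fg: "AE z in \<mu>. z \<in> S \<longrightarrow> w z \<noteq> 0 \<longrightarrow>
      w z * (\<integral>\<^sup>+y. ennreal (cmod (a y * b (- y + z))) \<partial>\<mu>)\<^sup>2
        \<le> (\<integral>\<^sup>+x\<in>S. D x \<partial>\<mu>) * nn_convolution \<mu> A B z"
  \<comment> \<open>The identity w = v D is used at the variable of integration itself, so this
    estimate holds at every z.\<close>
  proof (intro AE_I2 impI)
    fix z
    show "w z * (\<integral>\<^sup>+y. ennreal (cmod (a y * b (- y + z))) \<partial>\<mu>)\<^sup>2
        \<le> (\<integral>\<^sup>+x\<in>S. D x \<partial>\<mu>) * nn_convolution \<mu> A B z"
      unfolding nn_convolution_def
    proof (rule Cauchy_Schwarz_weight[OF mc[OF a b] DS conv_integrand_measurable[OF A B]])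
      show "AE y in \<mu>. (ennsqrt (w z) * ennreal (cmod (a y * b (- y + z))))\<^sup>2
          \<le> D y * indicator S y * (A y * B (- y + z))"
        using wD
      proof eventually_elim
        case (elim y)
        show ?case
        proof (cases "a y = 0 \<or> b (- y + z) = 0")
          case False
          then have y: "y \<in> S" "- y + z \<in> S"
            using a0 b0 by auto
          have "w z \<le> (v y * D y) * w (- y + z)"
            using sub'[OF y] elim False by simp
          from weighted_product_bound[OF this, of "a y" "b (- y + z)"] show ?thesis
            using y by (simp add: A_def B_def mult_ac)
        qed auto
      qed
    qed
  qed
  have key_gf: "AE z in \<mu>. z \<in> S \<longrightarrow> w z \<noteq> 0 \<longrightarrow>
      w z * (\<integral>\<^sup>+y. ennreal (cmod (b y * a (- y + z))) \<partial>\<mu>)\<^sup>2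
        \<le> (\<integral>\<^sup>+x\<in>S. D x \<partial>right_haar_of \<mu>) * nn_convolution \<mu> B A z"
  proof -
    \<comment> \<open>Here the identity is needed at -y + z. Its exceptional set is reflected by
      \<open>AE_reflected_null\<close>, with y confined to the \<sigma>-finite support of
      \<open>b\<close>; this costs a null set of points z.\<close>
    have "{u. \<not> (a u \<noteq> 0 \<longrightarrow> w u = v u * D u)} \<in> sets borel"
      by measurable
    then have N: "{u. \<not> (a u \<noteq> 0 \<longrightarrow> w u = v u * D u)} \<in> null_sets \<mu>"
      using wD by (subst AE_iff_null_sets) (auto)
    have "{y. b y \<noteq> 0} \<in> sets borel"
      by measurable
    from AE_reflected_null[OF N this sb] show ?thesis
    proof (eventually_elim, intro impI)
      fix z
      assume wD': "AE y in \<mu>. y \<in> {y. b y \<noteq> 0} \<longrightarrow>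
        - y + z \<notin> {u. \<not> (a u \<noteq> 0 \<longrightarrow> w u = v u * D u)}"
      show "w z * (\<integral>\<^sup>+y. ennreal (cmod (b y * a (- y + z))) \<partial>\<mu>)\<^sup>2
          \<le> (\<integral>\<^sup>+x\<in>S. D x \<partial>right_haar_of \<mu>) * nn_convolution \<mu> B A z"
        unfolding nn_convolution_def right_int[of z, symmetric]
      proof (rule Cauchy_Schwarz_weight[OF mc[OF b a] _ conv_integrand_measurable[OF B A]])
        show "(\<lambda>y. D (- y + z) * indicator S (- y + z)) \<in> borel_measurable borel"
          by (rule measurable_compose[OF measurable_reflection DS])
        show "AE y in \<mu>. (ennsqrt (w z) * ennreal (cmod (b y * a (- y + z))))\<^sup>2
            \<le> D (- y + z) * indicator S (- y + z) * (B y * A (- y + z))"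
          using wD'
        proof eventually_elim
          case (elim y)
          show ?case
          proof (cases "b y = 0 \<or> a (- y + z) = 0")
            case False
            then have y: "y \<in> S" "- y + z \<in> S"
              using a0 b0 by auto
            have "w z \<le> w y * (v (- y + z) * D (- y + z))"
              using sub'[OF y] elim False by simp
            from weighted_product_bound[OF this, of "b y" "a (- y + z)"] show ?thesis
              using y by (simp add: A_def B_def mult_ac)
          qed auto
        qed
      qed
    qed
  qed
  have norms: "ennsqrt ((\<integral>\<^sup>+x. A x \<partial>\<mu>) * (\<integral>\<^sup>+x. B x \<partial>\<mu>))
      \<le> L2_norm S (density \<mu> v) f * L2_norm S (density \<mu> w) g"
    unfolding ennsqrt_mult using fa(3) gb(3) by (rule mult_mono) auto
  have final: "ennsqrt (I * ((\<integral>\<^sup>+x. A x \<partial>\<mu>) * (\<integral>\<^sup>+x. B x \<partial>\<mu>)))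
      \<le> ennsqrt I * L2_norm S (density \<mu> v) f * L2_norm S (density \<mu> w) g" for I
    unfolding ennsqrt_mult[of I] mult.assoc using norms by (rule mult_left_mono) simp
  note fg = convolution_L2_bound[OF S w sub a[unfolded a_def] b[unfolded b_def]
      sa[unfolded a_def] sb[unfolded b_def] tonelli_sigma_finite[OF A B sA sB] fa(2) gb(2)
      key_fg[unfolded a_def b_def]]
  note gf = convolution_L2_bound[OF S w sub b[unfolded b_def] a[unfolded a_def]
      sb[unfolded b_def] sa[unfolded a_def] tonelli_sigma_finite[OF B A sB sA] gb(2) fa(2)
      key_gf[unfolded a_def b_def]]
  show "L2_norm S (density \<mu> w) (convolution S \<mu> f g)
      \<le> ennsqrt (\<integral>\<^sup>+x\<in>S. D x \<partial>\<mu>) * L2_norm S (density \<mu> v) f * L2_norm S (density \<mu> w) g"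
    using fg(1) final by (rule order_trans)
  show "L2_norm S (density \<mu> w) (convolution S \<mu> g f)
      \<le> ennsqrt (\<integral>\<^sup>+x\<in>S. D x \<partial>right_haar_of \<mu>) * L2_norm S (density \<mu> v) f * L2_norm S (density \<mu> w) g"
    using gf(1) final unfolding mult.commute[of "\<integral>\<^sup>+x. B x \<partial>\<mu>" "\<integral>\<^sup>+x. A x \<partial>\<mu>"] by (rule order_trans)
  show "convolution_in_L2 S \<mu> (density \<mu> w) f g" if "(\<integral>\<^sup>+x\<in>S. D x \<partial>\<mu>) < \<infinity>"
    by (rule fg(2)) (use that in auto)
  show "convolution_in_L2 S \<mu> (density \<mu> w) g f" if "(\<integral>\<^sup>+x\<in>S. D x \<partial>right_haar_of \<mu>) < \<infinity>"
    by (rule gf(2)) (use that in auto)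
qed

end

section \<open>The estimates for the sequence of measures and the algebra property\<close>

theorem theorem3p4:
  fixes \<mu> :: "'a::{topological_group_add, t2_space} measure"
    and S :: "'a set"
    and M :: "nat \<Rightarrow> 'a measure"
    and w :: "nat \<Rightarrow> 'a \<Rightarrow> ennreal"
    and D :: "nat \<Rightarrow> nat \<Rightarrow> 'a \<Rightarrow> ennreal"
  assumes "locally_compact_space (euclidean :: 'a topology)"
    and "left_haar_measure \<mu>"
    and "borel_semigroup S"
    and "\<And>p. 1 \<le> p \<Longrightarrow> sets (M p) = sets borel"
    and "absolutely_continuous \<mu> (M 1)"
    and "\<And>p. 1 \<le> p \<Longrightarrow> absolutely_continuous (M p) (M (Suc p))"
    and "\<And>p. 1 \<le> p \<Longrightarrow> is_RN_deriv \<mu> (M p) (w p)"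
    and "\<And>p q. 1 \<le> q \<Longrightarrow> q \<le> p \<Longrightarrow> is_RN_deriv (M q) (M p) (D p q)"
    and "\<And>p x y. 1 \<le> p \<Longrightarrow> x \<in> S \<Longrightarrow> y \<in> S \<Longrightarrow> w p (x + y) \<le> w p x * w p y"
  shows
    "(\<forall>p q f g. 1 \<le> q \<and> q \<le> p \<and> f \<in> L2 S (M q) \<and> g \<in> L2 S (M p) \<longrightarrow>
        L2_norm S (M p) (convolution S \<mu> f g)
          \<le> ennsqrt (\<integral>\<^sup>+x\<in>S. D p q x \<partial>\<mu>) * L2_norm S (M q) f * L2_norm S (M p) g \<and>
        ((\<integral>\<^sup>+x\<in>S. D p q x \<partial>\<mu>) < \<infinity> \<longrightarrow> convolution_in_L2 S \<mu> (M p) f g) \<and>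
        L2_norm S (M p) (convolution S \<mu> g f)
          \<le> ennsqrt (\<integral>\<^sup>+x\<in>S. D p q x \<partial>right_haar_of \<mu>) * L2_norm S (M q) f * L2_norm S (M p) g \<and>
        ((\<integral>\<^sup>+x\<in>S. D p q x \<partial>right_haar_of \<mu>) < \<infinity> \<longrightarrow> convolution_in_L2 S \<mu> (M p) g f))
     \<and>
     (\<forall>d::nat.
        (\<forall>p q. 1 \<le> q \<and> p > q + d \<longrightarrow>
           (\<integral>\<^sup>+x\<in>S. D p q x \<partial>\<mu>) < \<infinity> \<and> (\<integral>\<^sup>+x\<in>S. D p q x \<partial>right_haar_of \<mu>) < \<infinity>)
        \<longrightarrow>
        strong_convolution_algebra S \<mu> M \<and>
        (\<forall>p q. 1 \<le> q \<and> p > q + d \<longrightarrow>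
           convolution_bound S \<mu> M p q
             (sqrt (enn2real (max (\<integral>\<^sup>+x\<in>S. D p q x \<partial>\<mu>) (\<integral>\<^sup>+x\<in>S. D p q x \<partial>right_haar_of \<mu>))))))"
proof -
  interpret locally_compact_haar \<mu>
    by standard (fact assms(1), fact assms(2))
  let ?I = "\<lambda>p q. \<integral>\<^sup>+x\<in>S. D p q x \<partial>\<mu>"
  let ?J = "\<lambda>p q. \<integral>\<^sup>+x\<in>S. D p q x \<partial>right_haar_of \<mu>"
  have S: "S \<in> sets borel"
    using assms(3) by (simp add: borel_semigroup_def)
  have w: "w p \<in> borel_measurable borel" "density \<mu> (w p) = M p" if "1 \<le> p" for p
    using assms(7)[OF that] measurable_cong_sets[OF sets_haar refl, of "borel :: ennreal measure"]
    by (simp_all add: is_RN_deriv_def)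
  have bounds: "L2_norm S (M p) (convolution S \<mu> f g) \<le> ennsqrt (?I p q) * L2_norm S (M q) f * L2_norm S (M p) g"
      "?I p q < \<infinity> \<Longrightarrow> convolution_in_L2 S \<mu> (M p) f g"
      "L2_norm S (M p) (convolution S \<mu> g f) \<le> ennsqrt (?J p q) * L2_norm S (M q) f * L2_norm S (M p) g"
      "?J p q < \<infinity> \<Longrightarrow> convolution_in_L2 S \<mu> (M p) g f"
    if "1 \<le> q" "q \<le> p" "f \<in> L2 S (M q)" "g \<in> L2 S (M p)" for p q f g
  proof -
    have p: "1 \<le> p"
      using that by simp
    have "borel_measurable (M q) = borel_measurable borel"
      by (intro measurable_cong_sets assms(4) that refl)
    then have D: "D p q \<in> borel_measurable borel" "density (density \<mu> (w q)) (D p q) = density \<mu> (w p)"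
      using assms(8)[OF that(1,2)] unfolding is_RN_deriv_def w(2)[OF p] w(2)[OF that(1)] by blast+
    note * = weighted_convolution_bounds[OF S w(1)[OF that(1)] w(1)[OF p] D assms(9)[OF p],
        unfolded w(2)[OF p] w(2)[OF that(1)], OF _ _ that(3,4)]
    show "L2_norm S (M p) (convolution S \<mu> f g) \<le> ennsqrt (?I p q) * L2_norm S (M q) f * L2_norm S (M p) g"
      "?I p q < \<infinity> \<Longrightarrow> convolution_in_L2 S \<mu> (M p) f g"
      "L2_norm S (M p) (convolution S \<mu> g f) \<le> ennsqrt (?J p q) * L2_norm S (M q) f * L2_norm S (M p) g"
      "?J p q < \<infinity> \<Longrightarrow> convolution_in_L2 S \<mu> (M p) g f"
      using * by blast+
  qed
  \<comment> \<open>A bound with any larger \<open>A\<close> is wanted because the square root of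
    the maximum may be 0, whereas the algebra property asks for a positive constant.\<close>
  have conv_bound: "convolution_bound S \<mu> M p q A"
    if pq: "1 \<le> q" "q \<le> p" and fin: "?I p q < \<infinity>" "?J p q < \<infinity>"
      and A: "sqrt (enn2real (max (?I p q) (?J p q))) \<le> A" for p q A
  proof -
    have le: "ennsqrt c \<le> ennreal A" if "c \<le> max (?I p q) (?J p q)" for c
    proof -
      have "ennsqrt c \<le> ennsqrt (max (?I p q) (?J p q))"
        using that by (rule ennsqrt_mono)
      also have "\<dots> = ennreal (sqrt (enn2real (max (?I p q) (?J p q))))"
        using fin by (auto simp: ennsqrt_def max_def)
      also have "\<dots> \<le> ennreal A"
        using A by (rule ennreal_leI)
      finally show ?thesis .
    qed
    have le': "ennsqrt c * x * y \<le> ennreal A * x * y" if "c \<le> max (?I p q) (?J p q)" for c x y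
      using le[OF that] by (intro mult_right_mono) auto
    show ?thesis
      unfolding convolution_bound_def
    proof (intro ballI conjI)
      fix f g assume fg: "f \<in> L2 S (M q)" "g \<in> L2 S (M p)"
      note b = bounds[OF pq fg]
      show "convolution_in_L2 S \<mu> (M p) f g" "convolution_in_L2 S \<mu> (M p) g f"
        using b(2,4) fin by blast+
      show "L2_norm S (M p) (convolution S \<mu> f g) \<le> ennreal A * L2_norm S (M q) f * L2_norm S (M p) g"
        using b(1) le' by (rule order_trans) simp
      show "L2_norm S (M p) (convolution S \<mu> g f) \<le> ennreal A * L2_norm S (M q) f * L2_norm S (M p) g"
        using b(3) le' by (rule order_trans) simp
    qed
  qed
  show ?thesis
  proof (intro conjI)
    show "\<forall>p q f g. 1 \<le> q \<and> q \<le> p \<and> f \<in> L2 S (M q) \<and> g \<in> L2 S (M p) \<longrightarrow>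
        L2_norm S (M p) (convolution S \<mu> f g) \<le> ennsqrt (?I p q) * L2_norm S (M q) f * L2_norm S (M p) g \<and>
        (?I p q < \<infinity> \<longrightarrow> convolution_in_L2 S \<mu> (M p) f g) \<and>
        L2_norm S (M p) (convolution S \<mu> g f) \<le> ennsqrt (?J p q) * L2_norm S (M q) f * L2_norm S (M p) g \<and>
        (?J p q < \<infinity> \<longrightarrow> convolution_in_L2 S \<mu> (M p) g f)"
    proof (intro allI impI, elim conjE)
      fix p q f g assume "1 \<le> q" "q \<le> p" "f \<in> L2 S (M q)" "g \<in> L2 S (M p)"
      note b = bounds[OF this]
      show "L2_norm S (M p) (convolution S \<mu> f g) \<le> ennsqrt (?I p q) * L2_norm S (M q) f * L2_norm S (M p) g \<and>
        (?I p q < \<infinity> \<longrightarrow> convolution_in_L2 S \<mu> (M p) f g) \<and>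
        L2_norm S (M p) (convolution S \<mu> g f) \<le> ennsqrt (?J p q) * L2_norm S (M q) f * L2_norm S (M p) g \<and>
        (?J p q < \<infinity> \<longrightarrow> convolution_in_L2 S \<mu> (M p) g f)"
        by (intro conjI impI b)
    qed
    show "\<forall>d. (\<forall>p q. 1 \<le> q \<and> p > q + d \<longrightarrow> ?I p q < \<infinity> \<and> ?J p q < \<infinity>) \<longrightarrow>
        strong_convolution_algebra S \<mu> M \<and>
        (\<forall>p q. 1 \<le> q \<and> p > q + d \<longrightarrow>
          convolution_bound S \<mu> M p q (sqrt (enn2real (max (?I p q) (?J p q)))))"
    proof (intro allI impI conjI, unfold strong_convolution_algebra_def)
      fix d assume fin: "\<forall>p q. 1 \<le> q \<and> p > q + d \<longrightarrow> ?I p q < \<infinity> \<and> ?J p q < \<infinity>"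
      show "convolution_bound S \<mu> M p q (sqrt (enn2real (max (?I p q) (?J p q))))"
        if "1 \<le> q \<and> p > q + d" for p q
        using that fin by (intro conv_bound) auto
      have "\<exists>A>0. convolution_bound S \<mu> M p q A" if "1 \<le> q \<and> p > q + d" for p q
      proof (intro exI conjI)
        \<comment> \<open>The maximum with 1 ensures positivity when both integrals vanish.\<close>
        show "convolution_bound S \<mu> M p q (max 1 (sqrt (enn2real (max (?I p q) (?J p q)))))"
          using that fin by (intro conv_bound) auto
      qed simp
      then show "\<exists>d. \<forall>p q. 1 \<le> q \<and> p > q + d \<longrightarrow> (\<exists>A>0. convolution_bound S \<mu> M p q A)"
        by blast
    qed
  qed
qed

end
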